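(* Let $\mathcal C$ be a complete and cocomplete category, let $d\ge1$, regard $\mathbb R^d$ as a poset with the product order, and let $\rho=\rho_{\mathrm{diag}}$ be the height-difference function on $\mathbb R^d$ given by $\rho_{\mathrm{diag}}(a,b)=\min_{1\le i\le d}(b_i-a_i)$ for $a\le b$. Then: (1) For all $r\ge0$ there are natural isomorphisms of endofunctors of $\mathrm{Fun}(\mathbb R^d,\mathcal C)$: $\mathsf L_r^\rho\simeq(-r)$ and $\mathsf R_r^\rho\simeq(r)$, where $(t)$ denotes the $t$-shift functor. (2) Under the identifications in (1), the notion of $r$-interleaving induced by the $r$-shift functors coincides with the notion of $r$-height-interleaving with respect to $\rho$ on $\mathrm{Fun}(\mathbb R^d,\mathcal C)$. (3) The distance $d_\rho$ coincides with the classical interleaving distance $d_I$ on $\mathrm{Fun}(\mathbb R^d,\mathcal C)$.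
   Context: A poset $P$ is regarded as a category, and $\mathrm{Fun}(P,\mathcal C)$ is the category of functors $P\to\mathcal C$ and natural transformations. All infima of empty sets are $\infty$. Classical interleavings. For $t\in\mathbb R$ write $\vec t=(t,\dots,t)\in\mathbb R^d$. The $t$-shift functor sends $M$ to $M(t)$ with $M(t)(a)=M(a+\vec t)$ and $M(t)(a\le b)=M(a+\vec t\le b+\vec t)$, and acts on morphisms by $(f(t))(a)=f(a+\vec t)$. For $r\ge0$, $M$ and $N$ are $r$-interleaved if there are morphisms $f:M\to N(r)$ and $g:N\to M(r)$ such that $g(r)\circ f:M\to M(2r)$ and $f(r)\circ g:N\to N(2r)$ are the canonical morphisms with components $M(a\le a+2\vec r)$ and $N(a\le a+2\vec r)$. Set $d_I(M,N)=\inf\{r\ge0:M,N\text{ are }r\text{-interleaved}\}$. Height-interleavings. A height-difference function on a poset $P$ is a function $\rho:\{(a,b)\in P\times P: a\le b\}\to[0,\infty]$ with $\rho(a,a)=0$ for all $a$ and $\rho(a,c)\ge\rho(a,b)+\rho(b,c)$ whenever $a\le b\le c$. For $a\in P$ and real $r\ge 0$ put $a^{\downarrow_r}=\{x\in P: x\le a,\ \rho(x,a)\ge r\}$ and $a^{\uparrow_r}=\{x\in P: x\ge a,\ \rho(a,x)\ge r\}$ (full subposets). Endofunctors $\mathsf L_r=\mathsf L_r^\rho$ and $\mathsf R_r=\mathsf R_r^\rho$ of $\mathrm{Fun}(P,\mathcal C)$: $(\mathsf L_rM)(a)=\operatorname{colim} M|_{a^{\downarrow_r}}$ and $(\mathsf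 R_rM)(a)=\lim M|_{a^{\uparrow_r}}$, with structure morphisms for $a\le b$ (using $a^{\downarrow_r}\subseteq b^{\downarrow_r}$, $b^{\uparrow_r}\subseteq a^{\uparrow_r}$) and the action on morphisms induced by the universal properties. Write $\alpha_{a,M}(x):M(x)\to(\mathsf L_rM)(a)$ ($x\in a^{\downarrow_r}$) and $\beta_{a,M}(y):(\mathsf R_rM)(a)\to M(y)$ ($y\in a^{\uparrow_r}$) for the canonical maps. The functor $\mathsf L_r$ is left adjoint to $\mathsf R_r$; for $p:M\to\mathsf R_rN$, its adjoint $p^\sharp:\mathsf L_rM\to N$ is the unique morphism with $p^\sharp(a)\circ\alpha_{a,M}(x)=\beta_{x,N}(a)\circ p(x)$ for all $a\in P$, $x\in a^{\downarrow_r}$. Let $\eta^{\mathsf L}_{r,M}:\mathsf L_rM\to M$ and $\eta^{\mathsf R}_{r,M}:M\to\mathsf R_rM$ be induced by the structure maps $M(x\le a)$, $x\in a^{\downarrow_r}$, respectively $M(a\le y)$, $y\in a^{\uparrow_r}$, and set $e_{r,M}=\eta^{\mathsf R}_{r,M}\circ\eta^{\mathsf L}_{r,M}$. An $r$-height-interleaving between $M$ and $N$ with respect to $\rho$ is a pair $p:M\to\mathsf R_rN$, $q:N\to\mathsf R_rM$ with $e_{r,M}=q\circ p^\sharp$ and $e_{r,N}=p\circ q^\sharp$; $M,N$ are $r$-height-interleaved if one exists, and $d_\rho(M,N)=\inf\{r\ge0: M,N \text{ are } r\text{-height-interleaved}\}$. Part (2) means: identifying $\mathsf R_rN$ with $N(r)$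 and $\mathsf R_rM$ with $M(r)$ via (1), a pair of morphisms $M\to N(r)$, $N\to M(r)$ is an $r$-interleaving if and only if it is an $r$-height-interleaving. *)

theory Defs
  imports "HOL-Analysis.Analysis"
begin

section \<open>Categories, functors, natural transformations\<close>

text \<open>\<open>g \<cdot>\<^bsub>C\<^esub> f\<close> is \<open>g\<close> after \<open>f\<close>; it is meaningful only if \<open>Dom C g = Cod C f\<close>.\<close>

record ('o, 'm) cat_data =
  Obj :: "'o set"
  Arr :: "'m set"
  Dom :: "'m \<Rightarrow> 'o"
  Cod :: "'m \<Rightarrow> 'o"
  Ide :: "'o \<Rightarrow> 'm"
  Comp :: "'m \<Rightarrow> 'm \<Rightarrow> 'm"  (infixl "\<cdot>\<index>" 70)

definition Hom :: "('o, 'm) cat_data \<Rightarrow> 'o \<Rightarrow> 'o \<Rightarrow> 'm set" where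
  "Hom C a b = {f \<in> Arr C. Dom C f = a \<and> Cod C f = b}"

locale category =
  fixes C :: "('o, 'm) cat_data" (structure)
  assumes Dom_Obj: "f \<in> Arr C \<Longrightarrow> Dom C f \<in> Obj C"
    and Cod_Obj: "f \<in> Arr C \<Longrightarrow> Cod C f \<in> Obj C"
    and Ide_Hom: "a \<in> Obj C \<Longrightarrow> Ide C a \<in> Hom C a a"
    and Comp_Hom: "\<lbrakk>f \<in> Hom C a b; g \<in> Hom C b c\<rbrakk> \<Longrightarrow> g \<cdot> f \<in> Hom C a c"
    and Comp_Ide: "f \<in> Hom C a b \<Longrightarrow> f \<cdot> Ide C a = f"
    and Ide_Comp: "f \<in> Hom C a b \<Longrightarrow> Ide C b \<cdot> f = f"
    and Comp_assoc: "\<lbrakk>f \<in> Hom C a b; g \<in> Hom C b c; h \<in> Hom C c d\<rbrakk>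
                      \<Longrightarrow> h \<cdot> (g \<cdot> f) = (h \<cdot> g) \<cdot> f"

definition inverse_arrows :: "('o, 'm) cat_data \<Rightarrow> 'm \<Rightarrow> 'm \<Rightarrow> bool" where
  "inverse_arrows C f g \<longleftrightarrow>
     f \<in> Arr C \<and> g \<in> Hom C (Cod C f) (Dom C f) \<and>
     g \<cdot>\<^bsub>C\<^esub> f = Ide C (Dom C f) \<and> f \<cdot>\<^bsub>C\<^esub> g = Ide C (Cod C f)"

definition is_iso :: "('o, 'm) cat_data \<Rightarrow> 'm \<Rightarrow> bool" where
  "is_iso C f \<longleftrightarrow> (\<exists>g. inverse_arrows C f g)"

definition inv_arr :: "('o, 'm) cat_data \<Rightarrow> 'm \<Rightarrow> 'm" where
  "inv_arr C f = (THE g. inverse_arrows C f g)"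

text \<open>
  Functors and natural transformations take the value \<open>undefined\<close> outside the objects and arrows
  of their source (\<open>extensional\<close>). This makes the HOL equality of two of them coincide with the
  mathematical one, so that they form a category.
\<close>

record ('o, 'm, 'o2, 'm2) fctr =
  fobj :: "'o \<Rightarrow> 'o2"
  farr :: "'m \<Rightarrow> 'm2"

definition is_functor ::
  "('o, 'm) cat_data \<Rightarrow> ('o2, 'm2) cat_data \<Rightarrow> ('o, 'm, 'o2, 'm2) fctr \<Rightarrow> bool" where
  "is_functor J C F \<longleftrightarrow>
     fobj F \<in> Obj J \<rightarrow>\<^sub>E Obj C \<and>
     farr F \<in> extensional (Arr J) \<and>
     (\<forall>f \<in> Arr J. farr F f \<in> Hom C (fobj F (Dom J f)) (fobj F (Cod J f))) \<and>
     (\<forall>a \<in> Obj J. farr F (Ide J a) = Ide C (fobj F a)) \<and>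
     (\<forall>f \<in> Arr J. \<forall>g \<in> Arr J. Dom J g = Cod J f \<longrightarrow>
        farr F (g \<cdot>\<^bsub>J\<^esub> f) = farr F g \<cdot>\<^bsub>C\<^esub> farr F f)"

record ('o, 'm, 'o2, 'm2) ntrans =
  nt_dom :: "('o, 'm, 'o2, 'm2) fctr"
  nt_cod :: "('o, 'm, 'o2, 'm2) fctr"
  cmpt :: "'o \<Rightarrow> 'm2"

definition is_ntrans ::
  "('o, 'm) cat_data \<Rightarrow> ('o2, 'm2) cat_data \<Rightarrow> ('o, 'm, 'o2, 'm2) ntrans \<Rightarrow> bool" where
  "is_ntrans J C \<tau> \<longleftrightarrow>
     is_functor J C (nt_dom \<tau>) \<and> is_functor J C (nt_cod \<tau>) \<and>
     cmpt \<tau> \<in> extensional (Obj J) \<and>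
     (\<forall>a \<in> Obj J. cmpt \<tau> a \<in> Hom C (fobj (nt_dom \<tau>) a) (fobj (nt_cod \<tau>) a)) \<and>
     (\<forall>f \<in> Arr J. cmpt \<tau> (Cod J f) \<cdot>\<^bsub>C\<^esub> farr (nt_dom \<tau>) f
                 = farr (nt_cod \<tau>) f \<cdot>\<^bsub>C\<^esub> cmpt \<tau> (Dom J f))"

definition Fun ::
  "('o, 'm) cat_data \<Rightarrow> ('o2, 'm2) cat_data \<Rightarrow>
   (('o, 'm, 'o2, 'm2) fctr, ('o, 'm, 'o2, 'm2) ntrans) cat_data" where
  "Fun J C = \<lparr>
     Obj = {F. is_functor J C F},
     Arr = {\<tau>. is_ntrans J C \<tau>},
     Dom = nt_dom,
     Cod = nt_cod,
     Ide = (\<lambda>F. \<lparr>nt_dom = F, nt_cod = F, cmpt = (\<lambda>a\<in>Obj J. Ide C (fobj F a))\<rparr>),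
     Comp = (\<lambda>\<tau> \<sigma>. \<lparr>nt_dom = nt_dom \<sigma>, nt_cod = nt_cod \<tau>,
                      cmpt = (\<lambda>a\<in>Obj J. cmpt \<tau> a \<cdot>\<^bsub>C\<^esub> cmpt \<sigma> a)\<rparr>)\<rparr>"

definition natural_iso ::
  "('o, 'm) cat_data \<Rightarrow> ('o2, 'm2) cat_data \<Rightarrow> ('o, 'm, 'o2, 'm2) fctr \<Rightarrow>
   ('o, 'm, 'o2, 'm2) fctr \<Rightarrow> ('o, 'm, 'o2, 'm2) ntrans \<Rightarrow> bool" where
  "natural_iso J C F G \<tau> \<longleftrightarrow>
     \<tau> \<in> Hom (Fun J C) F G \<and> (\<forall>a \<in> Obj J. is_iso C (cmpt \<tau> a))"

definition restrict_fctr ::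
  "('o, 'm) cat_data \<Rightarrow> ('o, 'm, 'o2, 'm2) fctr \<Rightarrow> ('o, 'm, 'o2, 'm2) fctr" where
  "restrict_fctr J F = \<lparr>fobj = restrict (fobj F) (Obj J), farr = restrict (farr F) (Arr J)\<rparr>"


section \<open>Limits and colimits\<close>

definition is_cone ::
  "('o2, 'm2) cat_data \<Rightarrow> ('o, 'm) cat_data \<Rightarrow> ('o, 'm, 'o2, 'm2) fctr \<Rightarrow>
   'o2 \<Rightarrow> ('o \<Rightarrow> 'm2) \<Rightarrow> bool" where
  "is_cone C J F c \<pi> \<longleftrightarrow>
     c \<in> Obj C \<and> (\<forall>x \<in> Obj J. \<pi> x \<in> Hom C c (fobj F x)) \<and>
     (\<forall>f \<in> Arr J. farr F f \<cdot>\<^bsub>C\<^esub> \<pi> (Dom J f) = \<pi> (Cod J f))"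

definition is_limit ::
  "('o2, 'm2) cat_data \<Rightarrow> ('o, 'm) cat_data \<Rightarrow> ('o, 'm, 'o2, 'm2) fctr \<Rightarrow>
   'o2 \<Rightarrow> ('o \<Rightarrow> 'm2) \<Rightarrow> bool" where
  "is_limit C J F c \<pi> \<longleftrightarrow>
     is_cone C J F c \<pi> \<and>
     (\<forall>d \<mu>. is_cone C J F d \<mu> \<longrightarrow> (\<exists>!h. h \<in> Hom C d c \<and> (\<forall>x \<in> Obj J. \<pi> x \<cdot>\<^bsub>C\<^esub> h = \<mu> x)))"

definition is_cocone ::
  "('o2, 'm2) cat_data \<Rightarrow> ('o, 'm) cat_data \<Rightarrow> ('o, 'm, 'o2, 'm2) fctr \<Rightarrow>
   'o2 \<Rightarrow> ('o \<Rightarrow> 'm2) \<Rightarrow> bool" where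
  "is_cocone C J F c \<iota> \<longleftrightarrow>
     c \<in> Obj C \<and> (\<forall>x \<in> Obj J. \<iota> x \<in> Hom C (fobj F x) c) \<and>
     (\<forall>f \<in> Arr J. \<iota> (Cod J f) \<cdot>\<^bsub>C\<^esub> farr F f = \<iota> (Dom J f))"

definition is_colimit ::
  "('o2, 'm2) cat_data \<Rightarrow> ('o, 'm) cat_data \<Rightarrow> ('o, 'm, 'o2, 'm2) fctr \<Rightarrow>
   'o2 \<Rightarrow> ('o \<Rightarrow> 'm2) \<Rightarrow> bool" where
  "is_colimit C J F c \<iota> \<longleftrightarrow>
     is_cocone C J F c \<iota> \<and>
     (\<forall>d \<mu>. is_cocone C J F d \<mu> \<longrightarrow> (\<exists>!h. h \<in> Hom C c d \<and> (\<forall>x \<in> Obj J. h \<cdot>\<^bsub>C\<^esub> \<iota> x = \<mu> x)))"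

text \<open>
  Completeness means having the limits of all small diagrams. HOL cannot quantify over the types
  of the index categories, so the type \<open>'u\<close> plays the role of the universe: the small categories
  are those whose objects and arrows are elements of \<open>'u\<close>. An injection \<open>P \<times> P \<Rightarrow> 'u\<close> expresses
  that the subposets of a poset \<open>P\<close> are small.
\<close>

definition complete_category :: "'u itself \<Rightarrow> ('o, 'm) cat_data \<Rightarrow> bool" where
  "complete_category U C \<longleftrightarrow>
     category C \<and>
     (\<forall>(J :: ('u, 'u) cat_data) F. category J \<and> is_functor J C F \<longrightarrow> (\<exists>c \<pi>. is_limit C J F c \<pi>))"

definition cocomplete_category :: "'u itself \<Rightarrow> ('o, 'm) cat_data \<Rightarrow> bool" where
  "cocomplete_category U C \<longleftrightarrow>
     category C \<and>
     (\<forall>(J :: ('u, 'u) cat_data) F. category J \<and> is_functor J C F \<longrightarrow> (\<exists>c \<iota>. is_colimit C J F c \<iota>))"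

text \<open>An arbitrary choice of limits and colimits, where they exist.\<close>

definition the_limit where
  "the_limit C J F = (SOME (c, \<pi>). is_limit C J F c \<pi>)"

definition lim_obj ::
  "('o2, 'm2) cat_data \<Rightarrow> ('o, 'm) cat_data \<Rightarrow> ('o, 'm, 'o2, 'm2) fctr \<Rightarrow> 'o2" where
  "lim_obj C J F = fst (the_limit C J F)"

definition lim_proj ::
  "('o2, 'm2) cat_data \<Rightarrow> ('o, 'm) cat_data \<Rightarrow> ('o, 'm, 'o2, 'm2) fctr \<Rightarrow> 'o \<Rightarrow> 'm2" where
  "lim_proj C J F = snd (the_limit C J F)"

definition lim_induced ::
  "('o2, 'm2) cat_data \<Rightarrow> ('o, 'm) cat_data \<Rightarrow> ('o, 'm, 'o2, 'm2) fctr \<Rightarrow>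
   'o2 \<Rightarrow> ('o \<Rightarrow> 'm2) \<Rightarrow> 'm2" where
  "lim_induced C J F d \<mu> =
     (THE h. h \<in> Hom C d (lim_obj C J F) \<and> (\<forall>x \<in> Obj J. lim_proj C J F x \<cdot>\<^bsub>C\<^esub> h = \<mu> x))"

definition the_colimit where
  "the_colimit C J F = (SOME (c, \<iota>). is_colimit C J F c \<iota>)"

definition colim_obj ::
  "('o2, 'm2) cat_data \<Rightarrow> ('o, 'm) cat_data \<Rightarrow> ('o, 'm, 'o2, 'm2) fctr \<Rightarrow> 'o2" where
  "colim_obj C J F = fst (the_colimit C J F)"

definition colim_inj ::
  "('o2, 'm2) cat_data \<Rightarrow> ('o, 'm) cat_data \<Rightarrow> ('o, 'm, 'o2, 'm2) fctr \<Rightarrow> 'o \<Rightarrow> 'm2" where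
  "colim_inj C J F = snd (the_colimit C J F)"

definition colim_induced ::
  "('o2, 'm2) cat_data \<Rightarrow> ('o, 'm) cat_data \<Rightarrow> ('o, 'm, 'o2, 'm2) fctr \<Rightarrow>
   'o2 \<Rightarrow> ('o \<Rightarrow> 'm2) \<Rightarrow> 'm2" where
  "colim_induced C J F d \<mu> =
     (THE h. h \<in> Hom C (colim_obj C J F) d \<and> (\<forall>x \<in> Obj J. h \<cdot>\<^bsub>C\<^esub> colim_inj C J F x = \<mu> x))"


section \<open>Functors on a poset\<close>

text \<open>The unique arrow \<open>a \<rightarrow> b\<close> for \<open>a \<le> b\<close> is the pair \<open>(a, b)\<close>.\<close>

definition poset_cat :: "'p::order set \<Rightarrow> ('p, 'p \<times> 'p) cat_data" where
  "poset_cat A = \<lparr>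
     Obj = A,
     Arr = {(a, b). a \<in> A \<and> b \<in> A \<and> a \<le> b},
     Dom = fst,
     Cod = snd,
     Ide = (\<lambda>a. (a, a)),
     Comp = (\<lambda>g f. (fst f, snd g))\<rparr>"

type_synonym ('p, 'o, 'm) pfctr = "('p, 'p \<times> 'p, 'o, 'm) fctr"
type_synonym ('p, 'o, 'm) pntrans = "('p, 'p \<times> 'p, 'o, 'm) ntrans"
type_synonym ('p, 'o, 'm) pendo =
  "(('p, 'o, 'm) pfctr, ('p, 'o, 'm) pntrans, ('p, 'o, 'm) pfctr, ('p, 'o, 'm) pntrans) fctr"

abbreviation PFun ::
  "('o, 'm) cat_data \<Rightarrow> (('p::order, 'o, 'm) pfctr, ('p, 'o, 'm) pntrans) cat_data" where
  "PFun C \<equiv> Fun (poset_cat UNIV) C"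


section \<open>Height-interleavings\<close>

text \<open>Only the values \<open>\<rho> a b\<close> with \<open>a \<le> b\<close> matter.\<close>

definition height_difference :: "('p::order \<Rightarrow> 'p \<Rightarrow> ennreal) \<Rightarrow> bool" where
  "height_difference \<rho> \<longleftrightarrow>
     (\<forall>a. \<rho> a a = 0) \<and> (\<forall>a b c. a \<le> b \<and> b \<le> c \<longrightarrow> \<rho> a b + \<rho> b c \<le> \<rho> a c)"

definition down_set :: "('p::order \<Rightarrow> 'p \<Rightarrow> ennreal) \<Rightarrow> real \<Rightarrow> 'p \<Rightarrow> 'p set" where
  "down_set \<rho> r a = {x. x \<le> a \<and> ennreal r \<le> \<rho> x a}"

definition up_set :: "('p::order \<Rightarrow> 'p \<Rightarrow> ennreal) \<Rightarrow> real \<Rightarrow> 'p \<Rightarrow> 'p set" where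
  "up_set \<rho> r a = {x. a \<le> x \<and> ennreal r \<le> \<rho> a x}"

context
  fixes C :: "('o, 'm) cat_data" and \<rho> :: "'p::order \<Rightarrow> 'p \<Rightarrow> ennreal" and r :: real
begin

abbreviation (input) "down_cat a \<equiv> poset_cat (down_set \<rho> r a)"
abbreviation (input) "up_cat a \<equiv> poset_cat (up_set \<rho> r a)"
abbreviation (input) "down_diag a (M :: ('p, 'o, 'm) pfctr) \<equiv> restrict_fctr (down_cat a) M"
abbreviation (input) "up_diag a (M :: ('p, 'o, 'm) pfctr) \<equiv> restrict_fctr (up_cat a) M"

definition alpha :: "'p \<Rightarrow> ('p, 'o, 'm) pfctr \<Rightarrow> 'p \<Rightarrow> 'm" where
  "alpha a M = colim_inj C (down_cat a) (down_diag a M)"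

definition beta :: "'p \<Rightarrow> ('p, 'o, 'm) pfctr \<Rightarrow> 'p \<Rightarrow> 'm" where
  "beta a M = lim_proj C (up_cat a) (up_diag a M)"

definition L_obj :: "('p, 'o, 'm) pfctr \<Rightarrow> ('p, 'o, 'm) pfctr" where
  "L_obj M = \<lparr>
     fobj = (\<lambda>a. colim_obj C (down_cat a) (down_diag a M)),
     farr = restrict (\<lambda>(a, b). colim_induced C (down_cat a) (down_diag a M)
                                 (colim_obj C (down_cat b) (down_diag b M)) (alpha b M))
              (Arr (poset_cat UNIV))\<rparr>"

definition R_obj :: "('p, 'o, 'm) pfctr \<Rightarrow> ('p, 'o, 'm) pfctr" where
  "R_obj M = \<lparr>
     fobj = (\<lambda>a. lim_obj C (up_cat a) (up_diag a M)),
     farr = restrict (\<lambda>(a, b). lim_induced C (up_cat b) (up_diag b M)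
                                 (lim_obj C (up_cat a) (up_diag a M)) (beta a M))
              (Arr (poset_cat UNIV))\<rparr>"

definition L_arr :: "('p, 'o, 'm) pntrans \<Rightarrow> ('p, 'o, 'm) pntrans" where
  "L_arr f = \<lparr>
     nt_dom = L_obj (nt_dom f),
     nt_cod = L_obj (nt_cod f),
     cmpt = (\<lambda>a. colim_induced C (down_cat a) (down_diag a (nt_dom f)) (fobj (L_obj (nt_cod f)) a)
                   (\<lambda>x. alpha a (nt_cod f) x \<cdot>\<^bsub>C\<^esub> cmpt f x))\<rparr>"

definition R_arr :: "('p, 'o, 'm) pntrans \<Rightarrow> ('p, 'o, 'm) pntrans" where
  "R_arr f = \<lparr>
     nt_dom = R_obj (nt_dom f),
     nt_cod = R_obj (nt_cod f),
     cmpt = (\<lambda>a. lim_induced C (up_cat a) (up_diag a (nt_cod f)) (fobj (R_obj (nt_dom f)) a)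
                   (\<lambda>y. cmpt f y \<cdot>\<^bsub>C\<^esub> beta a (nt_dom f) y))\<rparr>"

definition L_functor :: "('p, 'o, 'm) pendo" where
  "L_functor = \<lparr>fobj = restrict L_obj (Obj (PFun C)), farr = restrict L_arr (Arr (PFun C))\<rparr>"

definition R_functor :: "('p, 'o, 'm) pendo" where
  "R_functor = \<lparr>fobj = restrict R_obj (Obj (PFun C)), farr = restrict R_arr (Arr (PFun C))\<rparr>"

definition sharp ::
  "('p, 'o, 'm) pfctr \<Rightarrow> ('p, 'o, 'm) pfctr \<Rightarrow> ('p, 'o, 'm) pntrans \<Rightarrow> ('p, 'o, 'm) pntrans" where
  "sharp M N p =
     (THE s. s \<in> Hom (PFun C) (L_obj M) N \<and>
        (\<forall>a. \<forall>x \<in> down_set \<rho> r a. cmpt s a \<cdot>\<^bsub>C\<^esub> alpha a M x = beta x N a \<cdot>\<^bsub>C\<^esub> cmpt p x))"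

definition eta_L :: "('p, 'o, 'm) pfctr \<Rightarrow> ('p, 'o, 'm) pntrans" where
  "eta_L M = \<lparr>
     nt_dom = L_obj M,
     nt_cod = M,
     cmpt = (\<lambda>a. colim_induced C (down_cat a) (down_diag a M) (fobj M a) (\<lambda>x. farr M (x, a)))\<rparr>"

definition eta_R :: "('p, 'o, 'm) pfctr \<Rightarrow> ('p, 'o, 'm) pntrans" where
  "eta_R M = \<lparr>
     nt_dom = M,
     nt_cod = R_obj M,
     cmpt = (\<lambda>a. lim_induced C (up_cat a) (up_diag a M) (fobj M a) (\<lambda>y. farr M (a, y)))\<rparr>"

definition e_map :: "('p, 'o, 'm) pfctr \<Rightarrow> ('p, 'o, 'm) pntrans" where
  "e_map M = eta_R M \<cdot>\<^bsub>PFun C\<^esub> eta_L M"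

definition height_interleaving ::
  "('p, 'o, 'm) pfctr \<Rightarrow> ('p, 'o, 'm) pfctr \<Rightarrow>
   ('p, 'o, 'm) pntrans \<Rightarrow> ('p, 'o, 'm) pntrans \<Rightarrow> bool" where
  "height_interleaving M N p q \<longleftrightarrow>
     p \<in> Hom (PFun C) M (R_obj N) \<and> q \<in> Hom (PFun C) N (R_obj M) \<and>
     e_map M = q \<cdot>\<^bsub>PFun C\<^esub> sharp M N p \<and>
     e_map N = p \<cdot>\<^bsub>PFun C\<^esub> sharp N M q"

end

definition d_height ::
  "('o, 'm) cat_data \<Rightarrow> ('p::order \<Rightarrow> 'p \<Rightarrow> ennreal) \<Rightarrow>
   ('p, 'o, 'm) pfctr \<Rightarrow> ('p, 'o, 'm) pfctr \<Rightarrow> ennreal" where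
  "d_height C \<rho> M N = Inf {ennreal r | r. 0 \<le> r \<and> (\<exists>p q. height_interleaving C \<rho> r M N p q)}"


section \<open>Classical interleavings on \<open>\<real>\<^sup>d\<close>\<close>

text \<open>
  The order on \<open>real ^ 'd\<close> is the library's componentwise order, and \<open>vec t\<close> is \<open>(t, \<dots>, t)\<close>.
\<close>

definition shift_obj :: "real \<Rightarrow> (real ^ 'd, 'o, 'm) pfctr \<Rightarrow> (real ^ 'd, 'o, 'm) pfctr" where
  "shift_obj t M = \<lparr>
     fobj = (\<lambda>a. fobj M (a + vec t)),
     farr = restrict (\<lambda>(a, b). farr M (a + vec t, b + vec t)) (Arr (poset_cat UNIV))\<rparr>"

definition shift_arr :: "real \<Rightarrow> (real ^ 'd, 'o, 'm) pntrans \<Rightarrow> (real ^ 'd, 'o, 'm) pntrans" where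
  "shift_arr t f = \<lparr>
     nt_dom = shift_obj t (nt_dom f),
     nt_cod = shift_obj t (nt_cod f),
     cmpt = (\<lambda>a. cmpt f (a + vec t))\<rparr>"

definition shift_functor :: "('o, 'm) cat_data \<Rightarrow> real \<Rightarrow> (real ^ 'd, 'o, 'm) pendo" where
  "shift_functor C t =
     \<lparr>fobj = restrict (shift_obj t) (Obj (PFun C)), farr = restrict (shift_arr t) (Arr (PFun C))\<rparr>"

definition canonical_shift :: "real \<Rightarrow> (real ^ 'd, 'o, 'm) pfctr \<Rightarrow> (real ^ 'd, 'o, 'm) pntrans" where
  "canonical_shift t M = \<lparr>
     nt_dom = M,
     nt_cod = shift_obj t M,
     cmpt = (\<lambda>a. farr M (a, a + vec t))\<rparr>"

definition interleaving ::
  "('o, 'm) cat_data \<Rightarrow> real \<Rightarrow> (real ^ 'd, 'o, 'm) pfctr \<Rightarrow> (real ^ 'd, 'o, 'm) pfctr \<Rightarrow>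
   (real ^ 'd, 'o, 'm) pntrans \<Rightarrow> (real ^ 'd, 'o, 'm) pntrans \<Rightarrow> bool" where
  "interleaving C r M N f g \<longleftrightarrow>
     f \<in> Hom (PFun C) M (shift_obj r N) \<and> g \<in> Hom (PFun C) N (shift_obj r M) \<and>
     shift_arr r g \<cdot>\<^bsub>PFun C\<^esub> f = canonical_shift (2 * r) M \<and>
     shift_arr r f \<cdot>\<^bsub>PFun C\<^esub> g = canonical_shift (2 * r) N"

definition d_interleaving ::
  "('o, 'm) cat_data \<Rightarrow> (real ^ 'd, 'o, 'm) pfctr \<Rightarrow> (real ^ 'd, 'o, 'm) pfctr \<Rightarrow> ennreal" where
  "d_interleaving C M N = Inf {ennreal r | r. 0 \<le> r \<and> (\<exists>f g. interleaving C r M N f g)}"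

definition rho_diag :: "real ^ 'd \<Rightarrow> real ^ 'd \<Rightarrow> ennreal" where
  "rho_diag a b = ennreal (MIN i. b $ i - a $ i)"

lemma height_difference_rho_diag: "height_difference (rho_diag :: real ^ 'd \<Rightarrow> _)"
  unfolding height_difference_def
proof (intro conjI allI impI)
  show "rho_diag a a = 0" for a :: "real ^ 'd"
    by (simp add: rho_diag_def)
next
  fix a b c :: "real ^ 'd"
  assume "a \<le> b \<and> b \<le> c"
  then have ab: "0 \<le> (MIN i. b $ i - a $ i)" and bc: "0 \<le> (MIN i. c $ i - b $ i)"
    by (auto simp: less_eq_vec_def)
  have "(MIN i. b $ i - a $ i) + (MIN i. c $ i - b $ i) \<le> c $ j - a $ j" for j
  proof -
    have "(MIN i. b $ i - a $ i) \<le> b $ j - a $ j" "(MIN i. c $ i - b $ i) \<le> c $ j - b $ j"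
      by (auto intro: Min_le)
    then show ?thesis by linarith
  qed
  then have "(MIN i. b $ i - a $ i) + (MIN i. c $ i - b $ i) \<le> (MIN i. c $ i - a $ i)"
    by auto
  then show "rho_diag a b + rho_diag b c \<le> rho_diag a c"
    unfolding rho_diag_def ennreal_plus[OF ab bc, symmetric] by (rule ennreal_leI)
qed

end

(*
  For r >= 0 the condition rho_diag x a >= r on x <= a says x <= a - (r,...,r), so the down-set
  of a has the greatest element a - (r,...,r), and dually the up-set has the least element
  a + (r,...,r). Hence the colimit is M (a - (r,...,r)), the limit is M (a + (r,...,r)), and
  L_r and R_r inherit functoriality and naturality from the shifts by transport along the
  canonical isomorphisms alpha and beta. If f : M -> N(r) and g : N -> M(r) correspond to p and
  q, then sharp p corresponds to f(-r), and cancelling these isomorphisms in e_M = q . sharp p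
  leaves g(a) . f(a - r) = M(a - r <= a + r), which is the interleaving identity at a - r.
*)
theory Submission
  imports Defs
begin

section \<open>Isomorphisms and functor categories\<close>

text \<open>The limits and colimits are arbitrary choices, so in general L_r M is only isomorphic to
  a shift, not equal to it, and its functor laws are not given in advance. The structure maps of L_r
  M and R_r M are brought into the form t_b^-1 . G(f) . t_a, that is, they are conjugates of the
  structure maps of a shift G by an invertible family t. This one formula yields functoriality and
  naturality of t together. The argument is applied on two levels: over R^d, where the family runs
  over the points a, and over the category of modules itself, where it runs over M. The second level
  asks for isomorphisms in the functor category, hence the preparation on inverting natural
  transformations componentwise. The conjugate form is available because the leg of a limit or
  colimit at the extreme element is invertible: an induced map is then a single leg of the inducing
  family composed with an inverse.\<close>

lemma inverse_arrows_iff: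
  "f \<in> Hom C a b \<Longrightarrow> inverse_arrows C f g \<longleftrightarrow>
     g \<in> Hom C b a \<and> g \<cdot>\<^bsub>C\<^esub> f = Ide C a \<and> f \<cdot>\<^bsub>C\<^esub> g = Ide C b"
  by (auto simp: inverse_arrows_def Hom_def)

lemma inverse_arrows_sym: "inverse_arrows C f g \<Longrightarrow> inverse_arrows C g f"
  by (auto simp: inverse_arrows_def Hom_def)

context category
begin

lemma inverse_arrows_unique:
  assumes "inverse_arrows C f g" "inverse_arrows C f g'"
  shows "g = g'"
proof -
  obtain a b where f: "f \<in> Hom C a b"
    using assms by (auto simp: inverse_arrows_def Hom_def)
  have g: "g \<in> Hom C b a" "g \<cdot> f = Ide C a" and g': "g' \<in> Hom C b a" "f \<cdot> g' = Ide C b"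
    using assms unfolding inverse_arrows_iff[OF f] by auto
  have "g = g \<cdot> (f \<cdot> g')" using Comp_Ide[OF g(1)] g' by simp
  also have "\<dots> = (g \<cdot> f) \<cdot> g'" by (rule Comp_assoc[OF g'(1) f g(1)])
  also have "\<dots> = g'" using Ide_Comp[OF g'(1)] g by simp
  finally show ?thesis .
qed

lemma inv_arr_eqI: "inverse_arrows C f g \<Longrightarrow> inv_arr C f = g"
  unfolding inv_arr_def by (rule the_equality) (assumption, rule inverse_arrows_unique)

lemma inverse_arrows_inv_arr: "is_iso C f \<Longrightarrow> inverse_arrows C f (inv_arr C f)"
  by (auto simp: is_iso_def inv_arr_eqI)

lemma inv_arr:
  assumes "is_iso C f" "f \<in> Hom C a b"
  shows "inv_arr C f \<in> Hom C b a" "inv_arr C f \<cdot> f = Ide C a" "f \<cdot> inv_arr C f = Ide C b"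
  using inverse_arrows_inv_arr[OF assms(1)] unfolding inverse_arrows_iff[OF assms(2)] by auto

lemma is_iso_inv_arr: "is_iso C f \<Longrightarrow> is_iso C (inv_arr C f)"
  using inverse_arrows_sym[OF inverse_arrows_inv_arr] by (auto simp: is_iso_def)

text \<open>Associativity depends on Hom memberships and cannot act as an unconditional rewrite
  rule, so cancellation is prepared for each side and each order of the two inverse arrows.\<close>

lemma inv_arr_comp_cancel:
  assumes "is_iso C f" "f \<in> Hom C a b"
  shows "h \<in> Hom C c a \<Longrightarrow> inv_arr C f \<cdot> (f \<cdot> h) = h"
    and "h \<in> Hom C c b \<Longrightarrow> f \<cdot> (inv_arr C f \<cdot> h) = h"
    and "h \<in> Hom C b c \<Longrightarrow> (h \<cdot> f) \<cdot> inv_arr C f = h"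
    and "h \<in> Hom C a c \<Longrightarrow> (h \<cdot> inv_arr C f) \<cdot> f = h"
proof -
  note i = inv_arr[OF assms] and f = assms(2)
  show "h \<in> Hom C c a \<Longrightarrow> inv_arr C f \<cdot> (f \<cdot> h) = h"
    using Comp_assoc[OF _ f i(1)] by (simp add: i Ide_Comp)
  show "h \<in> Hom C c b \<Longrightarrow> f \<cdot> (inv_arr C f \<cdot> h) = h"
    using Comp_assoc[OF _ i(1) f] by (simp add: i Ide_Comp)
  show "h \<in> Hom C b c \<Longrightarrow> (h \<cdot> f) \<cdot> inv_arr C f = h"
    using Comp_assoc[OF i(1) f] by (simp add: i Comp_Ide flip: Comp_assoc[OF i(1) f])
  show "h \<in> Hom C a c \<Longrightarrow> (h \<cdot> inv_arr C f) \<cdot> f = h"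
    using Comp_assoc[OF f i(1)] by (simp add: i Comp_Ide flip: Comp_assoc[OF f i(1)])
qed

text \<open>An invertible arrow is both mono and epi. The bracketing is the one in which the
  components of the height-interleaving equation appear, with inverses of \<alpha> and \<beta> in
  the roles of \<open>f\<close> and \<open>g\<close>.\<close>

lemma iso_cancel:
  assumes "is_iso C f" "f \<in> Hom C a b" "is_iso C g" "g \<in> Hom C c d" "x \<in> Hom C b c" "y \<in> Hom C b c"
  shows "g \<cdot> (x \<cdot> f) = g \<cdot> (y \<cdot> f) \<longleftrightarrow> x = y"
proof
  assume "g \<cdot> (x \<cdot> f) = g \<cdot> (y \<cdot> f)"
  then have "inv_arr C g \<cdot> (g \<cdot> (x \<cdot> f)) = inv_arr C g \<cdot> (g \<cdot> (y \<cdot> f))" by simp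
  then have "x \<cdot> f = y \<cdot> f"
    unfolding inv_arr_comp_cancel(1)[OF assms(3,4) Comp_Hom[OF assms(2,5)]]
      inv_arr_comp_cancel(1)[OF assms(3,4) Comp_Hom[OF assms(2,6)]] .
  then have "(x \<cdot> f) \<cdot> inv_arr C f = (y \<cdot> f) \<cdot> inv_arr C f" by simp
  then show "x = y"
    unfolding inv_arr_comp_cancel(3)[OF assms(1,2,5)] inv_arr_comp_cancel(3)[OF assms(1,2,6)] .
qed simp

end

lemma fctr_eqI: "fobj F = fobj G \<Longrightarrow> farr F = farr G \<Longrightarrow> (F :: ('a, 'b, 'c, 'd) fctr) = G"
  by (cases F, cases G) simp

lemma ntrans_eqI:
  "nt_dom s = nt_dom t \<Longrightarrow> nt_cod s = nt_cod t \<Longrightarrow> cmpt s = cmpt t \<Longrightarrow> (s :: ('a, 'b, 'c, 'd) ntrans) = t"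
  by (cases s, cases t) simp

lemma Fun_simps [simp]:
  "Obj (Fun J C) = {F. is_functor J C F}" "Arr (Fun J C) = {\<tau>. is_ntrans J C \<tau>}"
  "Dom (Fun J C) = nt_dom" "Cod (Fun J C) = nt_cod"
  "Ide (Fun J C) F = \<lparr>nt_dom = F, nt_cod = F, cmpt = (\<lambda>a\<in>Obj J. Ide C (fobj F a))\<rparr>"
  "\<tau> \<cdot>\<^bsub>Fun J C\<^esub> \<sigma> = \<lparr>nt_dom = nt_dom \<sigma>, nt_cod = nt_cod \<tau>,
                      cmpt = (\<lambda>a\<in>Obj J. cmpt \<tau> a \<cdot>\<^bsub>C\<^esub> cmpt \<sigma> a)\<rparr>"
  by (simp_all add: Fun_def)

lemma Hom_Fun_iff:
  "\<tau> \<in> Hom (Fun J C) F G \<longleftrightarrow>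
     nt_dom \<tau> = F \<and> nt_cod \<tau> = G \<and> is_functor J C F \<and> is_functor J C G \<and>
     cmpt \<tau> \<in> extensional (Obj J) \<and>
     (\<forall>a \<in> Obj J. cmpt \<tau> a \<in> Hom C (fobj F a) (fobj G a)) \<and>
     (\<forall>f \<in> Arr J. cmpt \<tau> (Cod J f) \<cdot>\<^bsub>C\<^esub> farr F f = farr G f \<cdot>\<^bsub>C\<^esub> cmpt \<tau> (Dom J f))"
  by (auto simp: Hom_def is_ntrans_def)

lemma Hom_Fun_cmpt:
  "\<tau> \<in> Hom (Fun J C) F G \<Longrightarrow> a \<in> Obj J \<Longrightarrow> cmpt \<tau> a \<in> Hom C (fobj F a) (fobj G a)"
  by (simp add: Hom_Fun_iff)

lemma functor_Hom:
  "is_functor J C F \<Longrightarrow> f \<in> Hom J a b \<Longrightarrow> farr F f \<in> Hom C (fobj F a) (fobj F b)"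
  by (auto simp: is_functor_def Hom_def)

lemma functor_Obj: "is_functor J C F \<Longrightarrow> a \<in> Obj J \<Longrightarrow> fobj F a \<in> Obj C"
  by (auto simp: is_functor_def)

text \<open>Makes the results on inverses applicable inside \<open>PFun C\<close> and lets
  \<open>PFun C\<close> itself serve as an index category for the endofunctors.\<close>

lemma category_Fun:
  assumes "category J" "category C"
  shows "category (Fun J C)"
proof -
  interpret J: category J by fact
  interpret C: category C by fact
  have arr: "f \<in> Arr J \<Longrightarrow> f \<in> Hom J (Dom J f) (Cod J f)" for f by (simp add: Hom_def)
  show ?thesis
  proof
    fix F assume "F \<in> Obj (Fun J C)"
    then have F: "is_functor J C F" by simp
    have "Ide C (fobj F (Cod J f)) \<cdot>\<^bsub>C\<^esub> farr F f = farr F f \<cdot>\<^bsub>C\<^esub> Ide C (fobj F (Dom J f))"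
      if "f \<in> Arr J" for f
      using C.Comp_Ide[OF functor_Hom[OF F arr[OF that]]] C.Ide_Comp[OF functor_Hom[OF F arr[OF that]]]
      by simp
    then show "Ide (Fun J C) F \<in> Hom (Fun J C) F F"
      using F unfolding Hom_Fun_iff
      by (auto intro!: C.Ide_Hom simp: functor_Obj J.Dom_Obj J.Cod_Obj)
  next
    fix s t F G H assume s: "s \<in> Hom (Fun J C) F G" and t: "t \<in> Hom (Fun J C) G H"
    have "(cmpt t (Cod J f) \<cdot>\<^bsub>C\<^esub> cmpt s (Cod J f)) \<cdot>\<^bsub>C\<^esub> farr F f =
          farr H f \<cdot>\<^bsub>C\<^esub> (cmpt t (Dom J f) \<cdot>\<^bsub>C\<^esub> cmpt s (Dom J f))"
      if f: "f \<in> Arr J" for f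
    proof -
      let ?a = "Dom J f" and ?b = "Cod J f"
      have ab: "?a \<in> Obj J" "?b \<in> Obj J" using f J.Dom_Obj J.Cod_Obj by auto
      have hs: "cmpt s ?a \<in> Hom C (fobj F ?a) (fobj G ?a)" "cmpt s ?b \<in> Hom C (fobj F ?b) (fobj G ?b)"
        and ht: "cmpt t ?a \<in> Hom C (fobj G ?a) (fobj H ?a)" "cmpt t ?b \<in> Hom C (fobj G ?b) (fobj H ?b)"
        and eq: "cmpt s ?b \<cdot>\<^bsub>C\<^esub> farr F f = farr G f \<cdot>\<^bsub>C\<^esub> cmpt s ?a"
          "cmpt t ?b \<cdot>\<^bsub>C\<^esub> farr G f = farr H f \<cdot>\<^bsub>C\<^esub> cmpt t ?a"
        and fns: "is_functor J C F" "is_functor J C G" "is_functor J C H"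
        using s t ab f unfolding Hom_Fun_iff by auto
      note h = fns[THEN functor_Hom, OF arr[OF f]]
      have "(cmpt t ?b \<cdot>\<^bsub>C\<^esub> cmpt s ?b) \<cdot>\<^bsub>C\<^esub> farr F f = cmpt t ?b \<cdot>\<^bsub>C\<^esub> (farr G f \<cdot>\<^bsub>C\<^esub> cmpt s ?a)"
        using C.Comp_assoc[OF h(1) hs(2) ht(2)] eq by simp
      also have "\<dots> = (farr H f \<cdot>\<^bsub>C\<^esub> cmpt t ?a) \<cdot>\<^bsub>C\<^esub> cmpt s ?a"
        using C.Comp_assoc[OF hs(1) h(2) ht(2)] eq by simp
      finally show ?thesis using C.Comp_assoc[OF hs(1) ht(1) h(3)] by simp
    qed
    then show "t \<cdot>\<^bsub>Fun J C\<^esub> s \<in> Hom (Fun J C) F H"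
      using s t C.Comp_Hom[OF s[THEN Hom_Fun_cmpt] t[THEN Hom_Fun_cmpt]]
      unfolding Hom_Fun_iff by (auto simp: J.Dom_Obj J.Cod_Obj)
  next
    fix t F G assume t: "t \<in> Hom (Fun J C) F G"
    note hom = Hom_Fun_cmpt[OF t]
    from t show "t \<cdot>\<^bsub>Fun J C\<^esub> Ide (Fun J C) F = t" "Ide (Fun J C) G \<cdot>\<^bsub>Fun J C\<^esub> t = t"
      using C.Comp_Ide[OF hom] C.Ide_Comp[OF hom] unfolding Hom_Fun_iff
      by (auto intro!: ntrans_eqI extensionalityI[of _ "Obj J"])
  next
    fix s t u F G H K
    assume "s \<in> Hom (Fun J C) F G" "t \<in> Hom (Fun J C) G H" "u \<in> Hom (Fun J C) H K"
    note C.Comp_assoc[OF this[THEN Hom_Fun_cmpt]]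
    then show "u \<cdot>\<^bsub>Fun J C\<^esub> (t \<cdot>\<^bsub>Fun J C\<^esub> s) = (u \<cdot>\<^bsub>Fun J C\<^esub> t) \<cdot>\<^bsub>Fun J C\<^esub> s"
      by (auto intro!: restrict_ext)
  qed (auto simp: is_ntrans_def)
qed

text \<open>Composing the naturality square of \<tau> with the inverse components on both sides
  gives the square for the inverses. The inverse is stated explicitly so that \<open>inv_arr\<close>
  in a functor category can be evaluated at an object.\<close>

lemma inverse_arrows_Fun:
  assumes "category J" "category C" and nat: "natural_iso J C F G \<tau>"
  shows "inverse_arrows (Fun J C) \<tau> \<lparr>nt_dom = G, nt_cod = F, cmpt = (\<lambda>a\<in>Obj J. inv_arr C (cmpt \<tau> a))\<rparr>"
proof -
  interpret J: category J by fact
  interpret C: category C by fact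
  let ?i = "\<lambda>a. inv_arr C (cmpt \<tau> a)"
  have \<tau>: "\<tau> \<in> Hom (Fun J C) F G" and iso: "\<And>a. a \<in> Obj J \<Longrightarrow> is_iso C (cmpt \<tau> a)"
    using nat by (auto simp: natural_iso_def)
  have F: "is_functor J C F" and G: "is_functor J C G"
    and hom: "\<And>a. a \<in> Obj J \<Longrightarrow> cmpt \<tau> a \<in> Hom C (fobj F a) (fobj G a)"
    and eq: "\<And>f. f \<in> Arr J \<Longrightarrow> cmpt \<tau> (Cod J f) \<cdot>\<^bsub>C\<^esub> farr F f = farr G f \<cdot>\<^bsub>C\<^esub> cmpt \<tau> (Dom J f)"
    using \<tau> unfolding Hom_Fun_iff by auto
  note inv = C.inv_arr[OF iso hom]
  have "?i (Cod J f) \<cdot>\<^bsub>C\<^esub> farr G f = farr F f \<cdot>\<^bsub>C\<^esub> ?i (Dom J f)" if f: "f \<in> Arr J" for f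
  proof -
    let ?a = "Dom J f" and ?b = "Cod J f"
    have ab: "?a \<in> Obj J" "?b \<in> Obj J" using f J.Dom_Obj J.Cod_Obj by auto
    have f': "f \<in> Hom J ?a ?b" using f by (simp add: Hom_def)
    note hF = functor_Hom[OF F f'] and hG = functor_Hom[OF G f']
    have "farr F f \<cdot>\<^bsub>C\<^esub> ?i ?a = ?i ?b \<cdot>\<^bsub>C\<^esub> (cmpt \<tau> ?b \<cdot>\<^bsub>C\<^esub> (farr F f \<cdot>\<^bsub>C\<^esub> ?i ?a))"
      using C.inv_arr_comp_cancel(1)[OF iso hom, OF ab(2) ab(2) C.Comp_Hom[OF inv(1) hF]] ab by simp
    also have "\<dots> = ?i ?b \<cdot>\<^bsub>C\<^esub> ((farr G f \<cdot>\<^bsub>C\<^esub> cmpt \<tau> ?a) \<cdot>\<^bsub>C\<^esub> ?i ?a)"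
      using C.Comp_assoc[OF inv(1) hF hom] ab eq[OF f] by simp
    also have "\<dots> = ?i ?b \<cdot>\<^bsub>C\<^esub> farr G f"
      using C.inv_arr_comp_cancel(3)[OF iso hom, OF ab(1) ab(1) hG] by simp
    finally show ?thesis by simp
  qed
  then have "\<lparr>nt_dom = G, nt_cod = F, cmpt = (\<lambda>a\<in>Obj J. ?i a)\<rparr> \<in> Hom (Fun J C) G F"
    unfolding Hom_Fun_iff using F G inv by (auto simp: J.Dom_Obj J.Cod_Obj)
  then show ?thesis
    unfolding inverse_arrows_iff[OF \<tau>]
    using \<tau> inv by (auto simp: Hom_Fun_iff intro!: restrict_ext)
qed

lemma is_iso_Fun:
  "category J \<Longrightarrow> category C \<Longrightarrow> natural_iso J C F G \<tau> \<Longrightarrow> is_iso (Fun J C) \<tau>"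
  using inverse_arrows_Fun unfolding is_iso_def by blast

text \<open>Transport of structure: \<open>F\<close> is at first a mere assignment on objects and
  arrows. Since its arrow part is that of \<open>G\<close> conjugated by \<tau>, the functor laws
  carry over from \<open>G\<close>, and naturality is the conjugation formula multiplied by
  \<tau>.\<close>

lemma natural_iso_transport:
  assumes "category J" "category C" and G: "is_functor J C G"
    and ext: "fobj F \<in> extensional (Obj J)" "farr F \<in> extensional (Arr J)"
    and iso: "\<And>a. a \<in> Obj J \<Longrightarrow> is_iso C (\<tau> a)"
    and hom: "\<And>a. a \<in> Obj J \<Longrightarrow> \<tau> a \<in> Hom C (fobj F a) (fobj G a)"
    and arr: "\<And>f. f \<in> Arr J \<Longrightarrow> farr F f = inv_arr C (\<tau> (Cod J f)) \<cdot>\<^bsub>C\<^esub> (farr G f \<cdot>\<^bsub>C\<^esub> \<tau> (Dom J f))"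
  shows "natural_iso J C F G \<lparr>nt_dom = F, nt_cod = G, cmpt = restrict \<tau> (Obj J)\<rparr>"
proof -
  interpret J: category J by fact
  interpret C: category C by fact
  let ?i = "\<lambda>a. inv_arr C (\<tau> a)"
  note inv = C.inv_arr[OF iso hom]
  have arrow: "f \<in> Arr J \<Longrightarrow> f \<in> Hom J (Dom J f) (Cod J f)" for f by (simp add: Hom_def)
  note hG = functor_Hom[OF G arrow]
  have hF: "farr F f \<in> Hom C (fobj F (Dom J f)) (fobj F (Cod J f))" if f: "f \<in> Arr J" for f
    unfolding arr[OF f]
    by (intro C.Comp_Hom[OF _ inv(1)] C.Comp_Hom[OF hom hG]) (auto simp: f J.Dom_Obj J.Cod_Obj)
  have nat: "\<tau> (Cod J f) \<cdot>\<^bsub>C\<^esub> farr F f = farr G f \<cdot>\<^bsub>C\<^esub> \<tau> (Dom J f)" if f: "f \<in> Arr J" for f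
    unfolding arr[OF f]
    by (rule C.inv_arr_comp_cancel(2)[OF iso hom C.Comp_Hom[OF hom hG]])
      (auto simp: f J.Dom_Obj J.Cod_Obj)
  have ide: "farr F (Ide J a) = Ide C (fobj F a)" if a: "a \<in> Obj J" for a
  proof -
    have i: "Ide J a \<in> Arr J" "Dom J (Ide J a) = a" "Cod J (Ide J a) = a"
      using J.Ide_Hom[OF a] by (auto simp: Hom_def)
    have "farr G (Ide J a) = Ide C (fobj G a)" using G a by (auto simp: is_functor_def)
    then show ?thesis
      using i inv[OF a a] C.Ide_Comp[OF hom[OF a]] by (simp add: arr)
  qed
  have comp: "farr F (g \<cdot>\<^bsub>J\<^esub> f) = farr F g \<cdot>\<^bsub>C\<^esub> farr F f"
    if fg: "f \<in> Arr J" "g \<in> Arr J" "Dom J g = Cod J f" for f g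
  proof -
    let ?a = "Dom J f" and ?b = "Cod J f" and ?c = "Cod J g"
    have abc: "?a \<in> Obj J" "?b \<in> Obj J" "?c \<in> Obj J" using fg J.Dom_Obj J.Cod_Obj by auto
    have "g \<cdot>\<^bsub>J\<^esub> f \<in> Hom J ?a ?c"
      using fg by (intro J.Comp_Hom[of _ _ ?b]) (auto simp: Hom_def)
    then have gf: "g \<cdot>\<^bsub>J\<^esub> f \<in> Arr J" "Dom J (g \<cdot>\<^bsub>J\<^esub> f) = ?a" "Cod J (g \<cdot>\<^bsub>J\<^esub> f) = ?c"
      by (auto simp: Hom_def)
    have Ggf: "farr G (g \<cdot>\<^bsub>J\<^esub> f) = farr G g \<cdot>\<^bsub>C\<^esub> farr G f" using G fg by (auto simp: is_functor_def)
    note hf = hG[OF fg(1)] and hg = hG[OF fg(2), unfolded fg(3)]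
    have "farr F (g \<cdot>\<^bsub>J\<^esub> f) = ?i ?c \<cdot>\<^bsub>C\<^esub> (farr G g \<cdot>\<^bsub>C\<^esub> (farr G f \<cdot>\<^bsub>C\<^esub> \<tau> ?a))"
      using arr[OF gf(1)] gf Ggf C.Comp_assoc[OF hom hf hg] abc by simp
    \<comment> \<open>Naturality at \<open>f\<close>, read from right to left, brings in the factor
      at \<open>?b\<close> that completes \<open>farr F g\<close>.\<close>
    also have "\<dots> = ?i ?c \<cdot>\<^bsub>C\<^esub> ((farr G g \<cdot>\<^bsub>C\<^esub> \<tau> ?b) \<cdot>\<^bsub>C\<^esub> farr F f)"
      using nat[OF fg(1)] C.Comp_assoc[OF hF[OF fg(1)] hom hg] abc by simp
    also have "\<dots> = farr F g \<cdot>\<^bsub>C\<^esub> farr F f"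
      using arr[OF fg(2)] fg(3) C.Comp_assoc[OF hF[OF fg(1)] C.Comp_Hom[OF hom hg] inv(1)] abc by simp
    finally show ?thesis .
  qed
  \<comment> \<open>Read off as the domain of an arrow; over \<open>PFun C\<close> this says that
    the values of \<open>F\<close> are functors.\<close>
  have "fobj F a \<in> Obj C" if a: "a \<in> Obj J" for a
    using hom[OF a] C.Dom_Obj[of "\<tau> a"] by (auto simp: Hom_def)
  then have F: "is_functor J C F"
    unfolding is_functor_def using ext hF ide comp by (auto simp: PiE_def)
  show ?thesis
    unfolding natural_iso_def Hom_Fun_iff
    using F G hom nat iso by (auto simp: J.Dom_Obj J.Cod_Obj)
qed

section \<open>Diagrams on a poset with a greatest or least element\<close>

lemma poset_cat_simps [simp]:
  "Obj (poset_cat A) = A" "Arr (poset_cat A) = {(a, b). a \<in> A \<and> b \<in> A \<and> a \<le> b}"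
  "Dom (poset_cat A) = fst" "Cod (poset_cat A) = snd" "Ide (poset_cat A) a = (a, a)"
  "g \<cdot>\<^bsub>poset_cat A\<^esub> f = (fst f, snd g)"
  by (simp_all add: poset_cat_def)

lemma Hom_poset_cat: "f \<in> Hom (poset_cat A) a b \<longleftrightarrow> f = (a, b) \<and> a \<in> A \<and> b \<in> A \<and> a \<le> b"
  by (auto simp: Hom_def)

lemma category_poset_cat: "category (poset_cat A)"
  by unfold_locales (auto simp: Hom_poset_cat)

lemma functor_poset_Hom:
  "is_functor (poset_cat A) C M \<Longrightarrow> a \<in> A \<Longrightarrow> b \<in> A \<Longrightarrow> a \<le> b \<Longrightarrow>
     farr M (a, b) \<in> Hom C (fobj M a) (fobj M b)"
  by (rule functor_Hom) (auto simp: Hom_poset_cat)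

lemma Hom_PFun_natural:
  "\<tau> \<in> Hom (PFun C) F G \<Longrightarrow> a \<le> b \<Longrightarrow>
     cmpt \<tau> b \<cdot>\<^bsub>C\<^esub> farr F (a, b) = farr G (a, b) \<cdot>\<^bsub>C\<^esub> cmpt \<tau> a"
  unfolding Hom_Fun_iff by (auto dest: bspec[of _ _ "(a, b)"])

lemma functor_poset_Ide:
  "is_functor (poset_cat A) C M \<Longrightarrow> a \<in> A \<Longrightarrow> farr M (a, a) = Ide C (fobj M a)"
  by (simp add: is_functor_def)

lemma functor_poset_Comp:
  assumes "is_functor (poset_cat A) C M" "a \<in> A" "b \<in> A" "c \<in> A" "a \<le> b" "b \<le> c"
  shows "farr M (b, c) \<cdot>\<^bsub>C\<^esub> farr M (a, b) = farr M (a, c)"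
proof -
  have "(a, b) \<in> Arr (poset_cat A)" "(b, c) \<in> Arr (poset_cat A)"
    "Dom (poset_cat A) (b, c) = Cod (poset_cat A) (a, b)"
    using assms by auto
  then have "farr M ((b, c) \<cdot>\<^bsub>poset_cat A\<^esub> (a, b)) = farr M (b, c) \<cdot>\<^bsub>C\<^esub> farr M (a, b)"
    using assms(1) unfolding is_functor_def by blast
  then show ?thesis by simp
qed

lemma is_functor_restrict_fctr:
  assumes "is_functor (poset_cat UNIV) C M"
  shows "is_functor (poset_cat A) C (restrict_fctr (poset_cat A) M)"
  unfolding is_functor_def restrict_fctr_def
  using assms functor_Obj[OF assms]
  by (auto simp: functor_poset_Hom functor_poset_Ide intro: order_trans functor_poset_Comp[symmetric])

lemma restrict_fctr_simps [simp]:
  "a \<in> A \<Longrightarrow> fobj (restrict_fctr (poset_cat A) M) a = fobj M a"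
  "a \<in> A \<Longrightarrow> b \<in> A \<Longrightarrow> a \<le> b \<Longrightarrow> farr (restrict_fctr (poset_cat A) M) (a, b) = farr M (a, b)"
  by (simp_all add: restrict_fctr_def)

lemma is_cocone_poset:
  "is_cocone C (poset_cat A) F d \<mu> \<longleftrightarrow>
     d \<in> Obj C \<and> (\<forall>x\<in>A. \<mu> x \<in> Hom C (fobj F x) d) \<and>
     (\<forall>x\<in>A. \<forall>y\<in>A. x \<le> y \<longrightarrow> \<mu> y \<cdot>\<^bsub>C\<^esub> farr F (x, y) = \<mu> x)"
  by (auto simp: is_cocone_def)

lemma is_cone_poset:
  "is_cone C (poset_cat A) F d \<mu> \<longleftrightarrow>
     d \<in> Obj C \<and> (\<forall>x\<in>A. \<mu> x \<in> Hom C d (fobj F x)) \<and>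
     (\<forall>x\<in>A. \<forall>y\<in>A. x \<le> y \<longrightarrow> farr F (x, y) \<cdot>\<^bsub>C\<^esub> \<mu> x = \<mu> y)"
  by (auto simp: is_cone_def)

context category
begin

text \<open>Every leg of a cocone factors through the leg at \<open>t\<close>, so a cocone is the
  same as an arrow out of \<open>F t\<close>. This provides the existence that turns the choice in
  \<open>the_colimit\<close> into a genuine colimit.\<close>

lemma colimit_poset_greatest:
  assumes F: "is_functor (poset_cat A) C F" and t: "t \<in> A" "\<And>x. x \<in> A \<Longrightarrow> x \<le> t"
  shows "is_colimit C (poset_cat A) F (fobj F t) (\<lambda>x. farr F (x, t))"
  unfolding is_colimit_def
proof (intro conjI allI impI)
  show "is_cocone C (poset_cat A) F (fobj F t) (\<lambda>x. farr F (x, t))"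
    unfolding is_cocone_poset
    using F t functor_Obj[OF F] by (auto simp: functor_poset_Hom functor_poset_Comp)
next
  fix d \<mu> assume \<mu>: "is_cocone C (poset_cat A) F d \<mu>"
  show "\<exists>!h. h \<in> Hom C (fobj F t) d \<and> (\<forall>x\<in>Obj (poset_cat A). h \<cdot> farr F (x, t) = \<mu> x)"
  proof (rule ex1I[of _ "\<mu> t"])
    show "\<mu> t \<in> Hom C (fobj F t) d \<and> (\<forall>x\<in>Obj (poset_cat A). \<mu> t \<cdot> farr F (x, t) = \<mu> x)"
      using \<mu> t unfolding is_cocone_poset by auto
  next
    fix h assume h: "h \<in> Hom C (fobj F t) d \<and> (\<forall>x\<in>Obj (poset_cat A). h \<cdot> farr F (x, t) = \<mu> x)"
    \<comment> \<open>The leg at \<open>t\<close> is an identity, so this one condition already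
      fixes \<open>h\<close>.\<close>
    then have "h \<cdot> farr F (t, t) = \<mu> t" using t by auto
    then show "h = \<mu> t" using h Comp_Ide functor_poset_Ide[OF F t(1)] by metis
  qed
qed

lemma limit_poset_least:
  assumes F: "is_functor (poset_cat A) C F" and t: "t \<in> A" "\<And>x. x \<in> A \<Longrightarrow> t \<le> x"
  shows "is_limit C (poset_cat A) F (fobj F t) (\<lambda>x. farr F (t, x))"
  unfolding is_limit_def
proof (intro conjI allI impI)
  show "is_cone C (poset_cat A) F (fobj F t) (\<lambda>x. farr F (t, x))"
    unfolding is_cone_poset
    using F t functor_Obj[OF F] by (auto simp: functor_poset_Hom functor_poset_Comp)
next
  fix d \<mu> assume \<mu>: "is_cone C (poset_cat A) F d \<mu>"
  show "\<exists>!h. h \<in> Hom C d (fobj F t) \<and> (\<forall>x\<in>Obj (poset_cat A). farr F (t, x) \<cdot> h = \<mu> x)"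
  proof (rule ex1I[of _ "\<mu> t"])
    show "\<mu> t \<in> Hom C d (fobj F t) \<and> (\<forall>x\<in>Obj (poset_cat A). farr F (t, x) \<cdot> \<mu> t = \<mu> x)"
      using \<mu> t unfolding is_cone_poset by auto
  next
    fix h assume h: "h \<in> Hom C d (fobj F t) \<and> (\<forall>x\<in>Obj (poset_cat A). farr F (t, x) \<cdot> h = \<mu> x)"
    then have "farr F (t, t) \<cdot> h = \<mu> t" using t by auto
    then show "h = \<mu> t" using h Ide_Comp functor_poset_Ide[OF F t(1)] by metis
  qed
qed

lemma is_colimit_the_colimit:
  assumes "is_colimit C J F c \<iota>"
  shows "is_colimit C J F (colim_obj C J F) (colim_inj C J F)"
proof -
  have "case the_colimit C J F of (c, \<iota>) \<Rightarrow> is_colimit C J F c \<iota>"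
    unfolding the_colimit_def by (rule someI[of _ "(c, \<iota>)"]) (simp add: assms)
  then show ?thesis by (simp add: colim_obj_def colim_inj_def case_prod_beta)
qed

lemma is_limit_the_limit:
  assumes "is_limit C J F c \<pi>"
  shows "is_limit C J F (lim_obj C J F) (lim_proj C J F)"
proof -
  have "case the_limit C J F of (c, \<pi>) \<Rightarrow> is_limit C J F c \<pi>"
    unfolding the_limit_def by (rule someI[of _ "(c, \<pi>)"]) (simp add: assms)
  then show ?thesis by (simp add: lim_obj_def lim_proj_def case_prod_beta)
qed

text \<open>The chosen colimit may differ from \<open>F t\<close>, but only by the isomorphism
  \<iota> \<open>t\<close>. Its inverse replaces the definite description in
  \<open>colim_induced\<close> by an explicit composite.\<close>

lemma colim_poset_greatest:
  assumes F: "is_functor (poset_cat A) C F" and t: "t \<in> A" "\<And>x. x \<in> A \<Longrightarrow> x \<le> t"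
  defines "\<iota> \<equiv> colim_inj C (poset_cat A) F" and "c \<equiv> colim_obj C (poset_cat A) F"
  shows "x \<in> A \<Longrightarrow> \<iota> x \<in> Hom C (fobj F x) c"
    and "x \<in> A \<Longrightarrow> \<iota> x = \<iota> t \<cdot> farr F (x, t)"
    and "is_iso C (\<iota> t)"
    and "is_cocone C (poset_cat A) F d \<mu> \<Longrightarrow>
           colim_induced C (poset_cat A) F d \<mu> = \<mu> t \<cdot> inv_arr C (\<iota> t)"
proof -
  have colim: "is_colimit C (poset_cat A) F c \<iota>"
    unfolding \<iota>_def c_def by (rule is_colimit_the_colimit[OF colimit_poset_greatest[OF F t]])
  then have cocone: "is_cocone C (poset_cat A) F c \<iota>"
    and univ: "\<And>d \<mu>. is_cocone C (poset_cat A) F d \<mu> \<Longrightarrow>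
                 \<exists>!h. h \<in> Hom C c d \<and> (\<forall>x \<in> A. h \<cdot> \<iota> x = \<mu> x)"
    by (auto simp: is_colimit_def)
  show hom: "x \<in> A \<Longrightarrow> \<iota> x \<in> Hom C (fobj F x) c" for x
    using cocone by (auto simp: is_cocone_poset)
  show top: "x \<in> A \<Longrightarrow> \<iota> x = \<iota> t \<cdot> farr F (x, t)" for x
    using cocone t by (auto simp: is_cocone_poset)
  have c: "c \<in> Obj C" using cocone by (auto simp: is_cocone_poset)
  have "is_cocone C (poset_cat A) F (fobj F t) (\<lambda>x. farr F (x, t))"
    using colimit_poset_greatest[OF F t] by (simp add: is_colimit_def)
  \<comment> \<open>The inverse of \<iota> \<open>t\<close>: the comparison map from the chosen
    colimit to the concrete one.\<close>
  from univ[OF this] obtain k where k: "k \<in> Hom C c (fobj F t)"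
    "\<And>x. x \<in> A \<Longrightarrow> k \<cdot> \<iota> x = farr F (x, t)" by blast
  have "(\<iota> t \<cdot> k) \<cdot> \<iota> x = \<iota> x" if "x \<in> A" for x
    using Comp_assoc[OF hom[OF that] k(1) hom[OF t(1)]] k(2)[OF that] top[OF that] by simp
  moreover have "Ide C c \<cdot> \<iota> x = \<iota> x" if "x \<in> A" for x
    using Ide_Comp[OF hom[OF that]] .
  \<comment> \<open>Both arrows mediate from the chosen cocone to itself, so uniqueness identifies
    them.\<close>
  ultimately have "\<iota> t \<cdot> k = Ide C c"
    using univ[OF cocone] Comp_Hom[OF k(1) hom[OF t(1)]] Ide_Hom[OF c] by blast
  then have inv: "inverse_arrows C (\<iota> t) k"
    unfolding inverse_arrows_iff[OF hom[OF t(1)]]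
    using k t functor_poset_Ide[OF F t(1)] by simp
  then show iso: "is_iso C (\<iota> t)" by (auto simp: is_iso_def)
  have k': "inv_arr C (\<iota> t) = k" by (rule inv_arr_eqI[OF inv])
  show "colim_induced C (poset_cat A) F d \<mu> = \<mu> t \<cdot> inv_arr C (\<iota> t)"
    if \<mu>: "is_cocone C (poset_cat A) F d \<mu>" for d \<mu>
  proof -
    have mt: "\<mu> t \<in> Hom C (fobj F t) d" and m: "x \<in> A \<Longrightarrow> \<mu> t \<cdot> farr F (x, t) = \<mu> x" for x
      using \<mu> t by (auto simp: is_cocone_poset)
    have "(\<mu> t \<cdot> k) \<cdot> \<iota> x = \<mu> x" if "x \<in> A" for x
      using Comp_assoc[OF hom[OF that] k(1) mt] k(2)[OF that] m[OF that] by simp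
    then have "\<mu> t \<cdot> k \<in> Hom C c d \<and> (\<forall>x\<in>A. (\<mu> t \<cdot> k) \<cdot> \<iota> x = \<mu> x)"
      using Comp_Hom[OF k(1) mt] by blast
    from the1_equality[OF univ[OF \<mu>] this] show ?thesis
      unfolding colim_induced_def k' by (simp add: \<iota>_def c_def)
  qed
qed

text \<open>Dual to \<open>colim_poset_greatest\<close>: the comparison map now leads into the
  chosen limit, so the inverse of \<pi> \<open>t\<close> stands on the left of the induced
  map.\<close>

lemma lim_poset_least:
  assumes F: "is_functor (poset_cat A) C F" and t: "t \<in> A" "\<And>x. x \<in> A \<Longrightarrow> t \<le> x"
  defines "\<pi> \<equiv> lim_proj C (poset_cat A) F" and "c \<equiv> lim_obj C (poset_cat A) F"
  shows "x \<in> A \<Longrightarrow> \<pi> x \<in> Hom C c (fobj F x)"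
    and "x \<in> A \<Longrightarrow> \<pi> x = farr F (t, x) \<cdot> \<pi> t"
    and "is_iso C (\<pi> t)"
    and "is_cone C (poset_cat A) F d \<mu> \<Longrightarrow>
           lim_induced C (poset_cat A) F d \<mu> = inv_arr C (\<pi> t) \<cdot> \<mu> t"
proof -
  have lim: "is_limit C (poset_cat A) F c \<pi>"
    unfolding \<pi>_def c_def by (rule is_limit_the_limit[OF limit_poset_least[OF F t]])
  then have cone: "is_cone C (poset_cat A) F c \<pi>"
    and univ: "\<And>d \<mu>. is_cone C (poset_cat A) F d \<mu> \<Longrightarrow>
                 \<exists>!h. h \<in> Hom C d c \<and> (\<forall>x \<in> A. \<pi> x \<cdot> h = \<mu> x)"
    by (auto simp: is_limit_def)
  show hom: "x \<in> A \<Longrightarrow> \<pi> x \<in> Hom C c (fobj F x)" for x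
    using cone by (auto simp: is_cone_poset)
  show top: "x \<in> A \<Longrightarrow> \<pi> x = farr F (t, x) \<cdot> \<pi> t" for x
    using cone t by (auto simp: is_cone_poset)
  have c: "c \<in> Obj C" using cone by (auto simp: is_cone_poset)
  have "is_cone C (poset_cat A) F (fobj F t) (\<lambda>x. farr F (t, x))"
    using limit_poset_least[OF F t] by (simp add: is_limit_def)
  from univ[OF this] obtain k where k: "k \<in> Hom C (fobj F t) c"
    "\<And>x. x \<in> A \<Longrightarrow> \<pi> x \<cdot> k = farr F (t, x)" by blast
  have "\<pi> x \<cdot> (k \<cdot> \<pi> t) = \<pi> x" if "x \<in> A" for x
    using Comp_assoc[OF hom[OF t(1)] k(1) hom[OF that]] k(2)[OF that] top[OF that] by simp
  moreover have "\<pi> x \<cdot> Ide C c = \<pi> x" if "x \<in> A" for x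
    using Comp_Ide[OF hom[OF that]] .
  ultimately have "k \<cdot> \<pi> t = Ide C c"
    using univ[OF cone] Comp_Hom[OF hom[OF t(1)] k(1)] Ide_Hom[OF c] by blast
  then have inv: "inverse_arrows C (\<pi> t) k"
    unfolding inverse_arrows_iff[OF hom[OF t(1)]]
    using k t functor_poset_Ide[OF F t(1)] by simp
  then show iso: "is_iso C (\<pi> t)" by (auto simp: is_iso_def)
  have k': "inv_arr C (\<pi> t) = k" by (rule inv_arr_eqI[OF inv])
  show "lim_induced C (poset_cat A) F d \<mu> = inv_arr C (\<pi> t) \<cdot> \<mu> t"
    if \<mu>: "is_cone C (poset_cat A) F d \<mu>" for d \<mu>
  proof -
    have mt: "\<mu> t \<in> Hom C d (fobj F t)" and m: "x \<in> A \<Longrightarrow> farr F (t, x) \<cdot> \<mu> t = \<mu> x" for x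
      using \<mu> t by (auto simp: is_cone_poset)
    have "\<pi> x \<cdot> (k \<cdot> \<mu> t) = \<mu> x" if "x \<in> A" for x
      using Comp_assoc[OF mt k(1) hom[OF that]] k(2)[OF that] m[OF that] by simp
    then have "k \<cdot> \<mu> t \<in> Hom C d c \<and> (\<forall>x\<in>A. \<pi> x \<cdot> (k \<cdot> \<mu> t) = \<mu> x)"
      using Comp_Hom[OF mt k(1)] by blast
    from the1_equality[OF univ[OF \<mu>] this] show ?thesis
      unfolding lim_induced_def k' by (simp add: \<pi>_def c_def)
  qed
qed

lemma inv_arr_inv_arr: "is_iso C f \<Longrightarrow> inv_arr C (inv_arr C f) = f"
  by (rule inv_arr_eqI[OF inverse_arrows_sym[OF inverse_arrows_inv_arr]])

end

section \<open>Shift functors\<close>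

text \<open>Reconciles the base point \<open>a + vec (- r)\<close> of the shift by
  \<open>- r\<close> with the point \<open>a - vec r\<close> at which \<alpha> is evaluated.\<close>

lemma vec_neg: "vec (- t) = - (vec t :: real ^ 'd)"
  by (simp add: vec_eq_iff)

lemma le_MIN_iff: "(t :: real) \<le> (MIN i :: 'd :: finite. h i) \<longleftrightarrow> (\<forall>i. t \<le> h i)"
  by (subst Min_ge_iff) auto

lemma rho_diag_ge_iff:
  assumes "0 \<le> r" "a \<le> b"
  shows "ennreal r \<le> rho_diag a b \<longleftrightarrow> a + vec r \<le> b"
proof -
  \<comment> \<open>\<open>ennreal\<close> sends negative reals to 0, so it reflects the inequality
    only once the minimum is known to be nonnegative; otherwise the case r = 0 would fail.\<close>
  have "0 \<le> (MIN i. b $ i - a $ i)"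
    using assms(2) by (simp add: le_MIN_iff less_eq_vec_def)
  then show ?thesis
    by (simp add: rho_diag_def le_MIN_iff less_eq_vec_def le_diff_eq add.commute)
qed

lemma le_add_vec: "0 \<le> r \<Longrightarrow> a \<le> a + vec r" for a :: "real ^ 'd"
  by (simp add: less_eq_vec_def)

lemma diff_vec_le: "0 \<le> r \<Longrightarrow> a - vec r \<le> a" for a :: "real ^ 'd"
  by (simp add: less_eq_vec_def)

lemma diff_vec_le_iff: "x \<le> a - vec r \<longleftrightarrow> x + vec r \<le> a" for a :: "real ^ 'd"
  by (simp add: less_eq_vec_def le_diff_eq)

text \<open>As r is nonnegative, \<open>a + vec r \<le> x\<close> implies \<open>a \<le> x\<close>,
  which leaves a principal up-set.\<close>

lemma up_set_rho_diag: "0 \<le> r \<Longrightarrow> up_set rho_diag r a = {a + vec r..}"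
  using order_trans[OF le_add_vec[of r a]] by (auto simp: up_set_def rho_diag_ge_iff)

lemma down_set_rho_diag: "0 \<le> r \<Longrightarrow> down_set rho_diag r a = {..a - vec r}"
  using order_trans[OF le_add_vec[of r], of _ a]
  by (auto simp: down_set_def rho_diag_ge_iff diff_vec_le_iff)

lemma shift_obj_simps [simp]:
  "fobj (shift_obj t M) a = fobj M (a + vec t)"
  "a \<le> b \<Longrightarrow> farr (shift_obj t M) (a, b) = farr M (a + vec t, b + vec t)"
  by (simp_all add: shift_obj_def)

lemma shift_arr_simps [simp]:
  "nt_dom (shift_arr t f) = shift_obj t (nt_dom f)"
  "nt_cod (shift_arr t f) = shift_obj t (nt_cod f)"
  "cmpt (shift_arr t f) a = cmpt f (a + vec t)"
  by (simp_all add: shift_arr_def)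

text \<open>An equality of functors rather than an isomorphism: it lets N(r)(-r) and M(r)(r) be
  rewritten as the codomains demanded by the adjoint and by the interleaving equation.\<close>

lemma shift_obj_shift_obj: "shift_obj s (shift_obj t M) = shift_obj (s + t) M"
  by (rule fctr_eqI) (auto simp: shift_obj_def vec_add add.assoc intro!: restrict_ext)

text \<open>The shift restricts its arrow map to actual arrows; equality needs \<open>farr M\<close>
  to be \<open>undefined\<close> elsewhere as well, which is part of being a functor.\<close>

lemma shift_obj_0:
  assumes "is_functor (poset_cat UNIV) C M"
  shows "shift_obj 0 M = M"
proof (rule fctr_eqI)
  have "farr M \<in> extensional {(a, b). a \<le> b}" using assms by (simp add: is_functor_def)
  then show "farr (shift_obj 0 M) = farr M"
    by (auto simp: shift_obj_def extensional_restrict case_prod_beta')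
qed (simp add: fun_eq_iff)

lemma is_functor_shift_obj:
  assumes "is_functor (poset_cat UNIV) C M"
  shows "is_functor (poset_cat UNIV) C (shift_obj t M)"
  unfolding is_functor_def
  using assms functor_Obj[OF assms]
  by (auto simp: functor_poset_Hom functor_poset_Ide shift_obj_def[of t]
      intro: order_trans functor_poset_Comp[symmetric])

lemma shift_arr_Hom:
  assumes "f \<in> Hom (PFun C) M N"
  shows "shift_arr t f \<in> Hom (PFun C) (shift_obj t M) (shift_obj t N)"
proof -
  have "cmpt f (b + vec t) \<cdot>\<^bsub>C\<^esub> farr M (a + vec t, b + vec t) =
        farr N (a + vec t, b + vec t) \<cdot>\<^bsub>C\<^esub> cmpt f (a + vec t)" if "a \<le> b" for a b
    using assms that add_right_mono[OF that, of "vec t"] unfolding Hom_Fun_iff by fastforce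
  then show ?thesis
    using assms unfolding Hom_Fun_iff by (auto simp: is_functor_shift_obj)
qed

lemma shift_functor_simps:
  "fobj (shift_functor C t) = restrict (shift_obj t) (Obj (PFun C))"
  "farr (shift_functor C t) = restrict (shift_arr t) (Arr (PFun C))"
  by (simp_all add: shift_functor_def)

text \<open>Supplies the functor \<open>G\<close> when \<open>natural_iso_transport\<close> is
  applied with \<open>PFun C\<close> as both source and target.\<close>

lemma is_functor_shift_functor:
  fixes C :: "('o, 'm) cat_data"
  assumes "category C"
  shows "is_functor (PFun C) (PFun C)
    (shift_functor C t :: (real ^ 'd, 'o, 'm) pendo)"
    (is "is_functor _ _ ?S")
proof -
  interpret P: category "PFun C :: ((real ^ 'd, 'o, 'm) pfctr, (real ^ 'd, 'o, 'm) pntrans) cat_data"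
    by (intro category_Fun category_poset_cat assms)
  note S = shift_functor_simps
  have arr: "f \<in> Hom (PFun C) (nt_dom f) (nt_cod f)" if "f \<in> Arr (PFun C)"
    for f :: "(real ^ 'd, 'o, 'm) pntrans"
    using that by (simp add: Hom_def)
  have ide: "farr ?S (Ide (PFun C) M) = Ide (PFun C) (fobj ?S M)" if M: "M \<in> Obj (PFun C)" for M
    unfolding S restrict_apply'[OF M] restrict_apply'[OF P.Ide_Hom[OF M, unfolded Hom_def, THEN CollectD, THEN conjunct1]]
    by (rule ntrans_eqI) (auto simp: fun_eq_iff)
  have comp: "farr ?S (g \<cdot>\<^bsub>PFun C\<^esub> f) = farr ?S g \<cdot>\<^bsub>PFun C\<^esub> farr ?S f"
    if f: "f \<in> Arr (PFun C)" and g: "g \<in> Arr (PFun C)" and "Dom (PFun C) g = Cod (PFun C) f" for f g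
  proof -
    \<comment> \<open>The restricted arrow map can be evaluated at the composite only after the
      composite is known to be an arrow.\<close>
    have "g \<cdot>\<^bsub>PFun C\<^esub> f \<in> Arr (PFun C)"
      using P.Comp_Hom[OF arr[OF f], of g "nt_cod g"] arr[OF g] that(3) by (simp add: Hom_def)
    then show ?thesis
      unfolding S restrict_apply'[OF f] restrict_apply'[OF g] restrict_apply'
      by (auto intro!: ntrans_eqI simp: fun_eq_iff)
  qed
  have hom: "farr ?S f \<in> Hom (PFun C) (fobj ?S (nt_dom f)) (fobj ?S (nt_cod f))"
    if f: "f \<in> Arr (PFun C)" for f
    using shift_arr_Hom[OF arr[OF f], of t] f P.Dom_Obj[OF f] P.Cod_Obj[OF f]
    unfolding S by simp
  show ?thesis
    unfolding is_functor_def[of "PFun C"] Fun_simps(3,4)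
    using hom ide comp[unfolded Fun_simps(3,4)] by (auto simp only: S restrict_extensional) (auto simp: is_functor_shift_obj)
qed


section \<open>Height-interleavings for the diagonal height difference\<close>

text \<open>The leg \<alpha> leads from M(a - r) into the colimit, so its inverse is taken to obtain
  an arrow from L_r M to the shift; for the limit, \<beta> already has the desired
  direction.\<close>

definition L_shift ::
  "('o, 'm) cat_data \<Rightarrow> real \<Rightarrow> (real ^ 'd, 'o, 'm) pfctr \<Rightarrow> (real ^ 'd, 'o, 'm) pntrans" where
  "L_shift C r M = \<lparr>nt_dom = L_obj C rho_diag r M, nt_cod = shift_obj (- r) M,
     cmpt = (\<lambda>a. inv_arr C (alpha C rho_diag r a M (a - vec r)))\<rparr>"

definition R_shift ::
  "('o, 'm) cat_data \<Rightarrow> real \<Rightarrow> (real ^ 'd, 'o, 'm) pfctr \<Rightarrow> (real ^ 'd, 'o, 'm) pntrans" where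
  "R_shift C r M = \<lparr>nt_dom = R_obj C rho_diag r M, nt_cod = shift_obj r M,
     cmpt = (\<lambda>a. beta C rho_diag r a M (a + vec r))\<rparr>"

section \<open>Canonical maps and pointwise identification with the shifts, for a fixed
  module\<close>

context
  fixes C :: "('o, 'm) cat_data" (structure) and r :: real
  assumes C: "category C" and r: "0 \<le> r"
begin

interpretation category C by (rule C)

context
  fixes M :: "(real ^ 'd, 'o, 'm) pfctr"
  assumes M: "is_functor (poset_cat UNIV) C M"
begin

text \<open>The general result at the greatest element \<open>a - vec r\<close>, with hypotheses and
  values expressed through \<open>M\<close> instead of its restriction to the down-set.\<close>

lemma
  shows alpha_Hom: "x \<le> a - vec r \<Longrightarrow>
      alpha C rho_diag r a M x \<in> Hom C (fobj M x) (fobj (L_obj C rho_diag r M) a)"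
    and alpha_eq: "x \<le> a - vec r \<Longrightarrow>
      alpha C rho_diag r a M x = alpha C rho_diag r a M (a - vec r) \<cdot> farr M (x, a - vec r)"
    and is_iso_alpha: "is_iso C (alpha C rho_diag r a M (a - vec r))"
    and colim_induced_down_set:
      "c \<in> Obj C \<Longrightarrow> (\<And>x. x \<le> a - vec r \<Longrightarrow> \<mu> x \<in> Hom C (fobj M x) c) \<Longrightarrow>
       (\<And>x y. x \<le> y \<Longrightarrow> y \<le> a - vec r \<Longrightarrow> \<mu> y \<cdot> farr M (x, y) = \<mu> x) \<Longrightarrow>
       colim_induced C (poset_cat (down_set rho_diag r a))
         (restrict_fctr (poset_cat (down_set rho_diag r a)) M) c \<mu> =
       \<mu> (a - vec r) \<cdot> inv_arr C (alpha C rho_diag r a M (a - vec r))"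
proof -
  let ?A = "down_set rho_diag r a"
  have t: "a - vec r \<in> ?A" "\<And>x. x \<in> ?A \<Longrightarrow> x \<le> a - vec r"
    using r by (auto simp: down_set_rho_diag)
  note colim = colim_poset_greatest[OF is_functor_restrict_fctr[OF M] t]
  have A: "x \<in> ?A \<longleftrightarrow> x \<le> a - vec r" for x using r by (simp add: down_set_rho_diag)
  show "x \<le> a - vec r \<Longrightarrow>
      alpha C rho_diag r a M x \<in> Hom C (fobj M x) (fobj (L_obj C rho_diag r M) a)"
    using colim(1)[of x] A[of x] by (simp add: alpha_def L_obj_def)
  show "x \<le> a - vec r \<Longrightarrow>
      alpha C rho_diag r a M x = alpha C rho_diag r a M (a - vec r) \<cdot> farr M (x, a - vec r)"
    using colim(2)[of x] by (simp add: A alpha_def)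
  show "is_iso C (alpha C rho_diag r a M (a - vec r))"
    using colim(3) by (simp add: alpha_def)
  show "colim_induced C (poset_cat ?A) (restrict_fctr (poset_cat ?A) M) c \<mu> =
       \<mu> (a - vec r) \<cdot> inv_arr C (alpha C rho_diag r a M (a - vec r))"
    if "c \<in> Obj C" "\<And>x. x \<le> a - vec r \<Longrightarrow> \<mu> x \<in> Hom C (fobj M x) c"
      "\<And>x y. x \<le> y \<Longrightarrow> y \<le> a - vec r \<Longrightarrow> \<mu> y \<cdot> farr M (x, y) = \<mu> x"
    unfolding alpha_def by (rule colim(4)) (use that in \<open>auto simp: is_cocone_poset A\<close>)
qed

lemma
  shows beta_Hom: "a + vec r \<le> x \<Longrightarrow>
      beta C rho_diag r a M x \<in> Hom C (fobj (R_obj C rho_diag r M) a) (fobj M x)"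
    and beta_eq: "a + vec r \<le> x \<Longrightarrow>
      beta C rho_diag r a M x = farr M (a + vec r, x) \<cdot> beta C rho_diag r a M (a + vec r)"
    and is_iso_beta: "is_iso C (beta C rho_diag r a M (a + vec r))"
    and lim_induced_up_set:
      "c \<in> Obj C \<Longrightarrow> (\<And>x. a + vec r \<le> x \<Longrightarrow> \<mu> x \<in> Hom C c (fobj M x)) \<Longrightarrow>
       (\<And>x y. a + vec r \<le> x \<Longrightarrow> x \<le> y \<Longrightarrow> farr M (x, y) \<cdot> \<mu> x = \<mu> y) \<Longrightarrow>
       lim_induced C (poset_cat (up_set rho_diag r a))
         (restrict_fctr (poset_cat (up_set rho_diag r a)) M) c \<mu> =
       inv_arr C (beta C rho_diag r a M (a + vec r)) \<cdot> \<mu> (a + vec r)"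
proof -
  let ?A = "up_set rho_diag r a"
  have t: "a + vec r \<in> ?A" "\<And>x. x \<in> ?A \<Longrightarrow> a + vec r \<le> x"
    using r by (auto simp: up_set_rho_diag)
  note lim = lim_poset_least[OF is_functor_restrict_fctr[OF M] t]
  have A: "x \<in> ?A \<longleftrightarrow> a + vec r \<le> x" for x using r by (simp add: up_set_rho_diag)
  show "a + vec r \<le> x \<Longrightarrow>
      beta C rho_diag r a M x \<in> Hom C (fobj (R_obj C rho_diag r M) a) (fobj M x)"
    using lim(1)[of x] A[of x] by (simp add: beta_def R_obj_def)
  show "a + vec r \<le> x \<Longrightarrow>
      beta C rho_diag r a M x = farr M (a + vec r, x) \<cdot> beta C rho_diag r a M (a + vec r)"
    using lim(2)[of x] by (simp add: A beta_def)
  show "is_iso C (beta C rho_diag r a M (a + vec r))"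
    using lim(3) by (simp add: beta_def)
  show "lim_induced C (poset_cat ?A) (restrict_fctr (poset_cat ?A) M) c \<mu> =
       inv_arr C (beta C rho_diag r a M (a + vec r)) \<cdot> \<mu> (a + vec r)"
    if "c \<in> Obj C" "\<And>x. a + vec r \<le> x \<Longrightarrow> \<mu> x \<in> Hom C c (fobj M x)"
      "\<And>x y. a + vec r \<le> x \<Longrightarrow> x \<le> y \<Longrightarrow> farr M (x, y) \<cdot> \<mu> x = \<mu> y"
    unfolding beta_def by (rule lim(4)) (use that in \<open>auto simp: is_cone_poset A\<close>)
qed

text \<open>The cocone law of \<alpha>, used to check that the families inducing the arrows of
  \<open>L_obj\<close> and the components of \<open>L_arr\<close> are cocones.\<close>

lemma alpha_comp_farr:
  assumes "x \<le> y" "y \<le> a - vec r"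
  shows "alpha C rho_diag r a M y \<cdot> farr M (x, y) = alpha C rho_diag r a M x"
proof -
  have xy: "farr M (x, y) \<in> Hom C (fobj M x) (fobj M y)"
    and y: "farr M (y, a - vec r) \<in> Hom C (fobj M y) (fobj M (a - vec r))"
    using assms by (auto intro: functor_poset_Hom[OF M])
  show ?thesis
    using alpha_eq[OF assms(2)] alpha_eq[OF order_trans[OF assms]] Comp_assoc[OF xy y alpha_Hom]
      functor_poset_Comp[OF M _ _ _ assms] by simp
qed

lemma farr_comp_beta:
  assumes "a + vec r \<le> x" "x \<le> y"
  shows "farr M (x, y) \<cdot> beta C rho_diag r a M x = beta C rho_diag r a M y"
proof -
  have xy: "farr M (x, y) \<in> Hom C (fobj M x) (fobj M y)"
    and x: "farr M (a + vec r, x) \<in> Hom C (fobj M (a + vec r)) (fobj M x)"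
    using assms by (auto intro: functor_poset_Hom[OF M])
  show ?thesis
    using beta_eq[OF assms(1)] beta_eq[OF order_trans[OF assms]] Comp_assoc[OF beta_Hom x xy]
      functor_poset_Comp[OF M _ _ _ assms] by simp
qed

lemma L_obj_Obj: "fobj (L_obj C rho_diag r M) a \<in> Obj C"
  using Cod_Obj[of "alpha C rho_diag r a M (a - vec r)"] alpha_Hom[of "a - vec r" a]
  by (auto simp: Hom_def)

lemma R_obj_Obj: "fobj (R_obj C rho_diag r M) a \<in> Obj C"
  using Dom_Obj[of "beta C rho_diag r a M (a + vec r)"] beta_Hom[of a "a + vec r"]
  by (auto simp: Hom_def)

text \<open>The arrow for a \<le> b is induced by the legs into the colimit at b, hence equals the
  leg from a - r followed after the inverse leg at a. Factoring the former through b - r exposes the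
  structure map of the shift, and the remaining leg is the inverse of the component at b.\<close>

lemma natural_iso_L_shift:
  "natural_iso (poset_cat UNIV) C (L_obj C rho_diag r M) (shift_obj (- r) M) (L_shift C r M)"
proof -
  let ?L = "L_obj C rho_diag r M" and ?\<tau> = "\<lambda>a. inv_arr C (alpha C rho_diag r a M (a - vec r))"
  have arr: "farr ?L (a, b) =
      inv_arr C (?\<tau> b) \<cdot> (farr (shift_obj (- r) M) (a, b) \<cdot> ?\<tau> a)" if ab: "a \<le> b" for a b
  proof -
    have le: "a - vec r \<le> b - vec r" using ab by simp
    have "farr ?L (a, b) = alpha C rho_diag r b M (a - vec r) \<cdot> ?\<tau> a"
      using ab L_obj_Obj[of b] alpha_Hom[OF order_trans[OF _ le]] alpha_comp_farr[OF _ order_trans[OF _ le]]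
      by (subst colim_induced_down_set[symmetric]) (auto simp: L_obj_def)
    also have "\<dots> = (alpha C rho_diag r b M (b - vec r) \<cdot> farr M (a - vec r, b - vec r)) \<cdot> ?\<tau> a"
      using alpha_eq[OF le] by simp
    also have "\<dots> = alpha C rho_diag r b M (b - vec r) \<cdot> (farr M (a - vec r, b - vec r) \<cdot> ?\<tau> a)"
      using Comp_assoc[OF inv_arr(1)[OF is_iso_alpha alpha_Hom] functor_poset_Hom[OF M _ _ le] alpha_Hom]
      by simp
    finally show ?thesis
      using ab by (simp add: inv_arr_inv_arr is_iso_alpha vec_neg)
  qed
  note transport = natural_iso_transport[where F = ?L and \<tau> = ?\<tau>, OF category_poset_cat C
      is_functor_shift_obj[OF M], of "- r"]
  have hom: "?\<tau> a \<in> Hom C (fobj ?L a) (fobj M (a - vec r))" for a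
    by (rule inv_arr(1)[OF is_iso_alpha alpha_Hom]) simp
  have ext: "farr ?L \<in> extensional (Arr (poset_cat UNIV))"
    by (simp add: L_obj_def)
  have "natural_iso (poset_cat UNIV) C ?L (shift_obj (- r) M)
      \<lparr>nt_dom = ?L, nt_cod = shift_obj (- r) M, cmpt = restrict ?\<tau> (Obj (poset_cat UNIV))\<rparr>"
    by (rule transport) (use arr hom ext in \<open>auto simp: is_iso_inv_arr is_iso_alpha vec_neg\<close>)
  then show "natural_iso (poset_cat UNIV) C ?L (shift_obj (- r) M) (L_shift C r M)"
    by (simp add: L_shift_def restrict_UNIV)
qed

lemma natural_iso_R_shift:
  "natural_iso (poset_cat UNIV) C (R_obj C rho_diag r M) (shift_obj r M) (R_shift C r M)"
proof -
  let ?R = "R_obj C rho_diag r M" and ?\<tau> = "\<lambda>a. beta C rho_diag r a M (a + vec r)"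
  have arr: "farr ?R (a, b) =
      inv_arr C (?\<tau> b) \<cdot> (farr (shift_obj r M) (a, b) \<cdot> ?\<tau> a)" if ab: "a \<le> b" for a b
  proof -
    have le: "a + vec r \<le> b + vec r" using ab by simp
    have "farr ?R (a, b) = inv_arr C (?\<tau> b) \<cdot> beta C rho_diag r a M (b + vec r)"
      using ab R_obj_Obj[of a] beta_Hom[OF order_trans[OF le]] farr_comp_beta[OF order_trans[OF le]]
      by (subst lim_induced_up_set[symmetric]) (auto simp: R_obj_def)
    then show ?thesis
      using ab beta_eq[OF le] by simp
  qed
  note transport = natural_iso_transport[where F = ?R and \<tau> = ?\<tau>, OF category_poset_cat C
      is_functor_shift_obj[OF M], of r]
  have hom: "?\<tau> a \<in> Hom C (fobj ?R a) (fobj M (a + vec r))" for a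
    by (rule beta_Hom) simp
  have ext: "farr ?R \<in> extensional (Arr (poset_cat UNIV))"
    by (simp add: R_obj_def)
  have "natural_iso (poset_cat UNIV) C ?R (shift_obj r M)
      \<lparr>nt_dom = ?R, nt_cod = shift_obj r M, cmpt = restrict ?\<tau> (Obj (poset_cat UNIV))\<rparr>"
    by (rule transport) (use arr hom ext in \<open>auto simp: is_iso_beta\<close>)
  then show "natural_iso (poset_cat UNIV) C ?R (shift_obj r M) (R_shift C r M)"
    by (simp add: R_shift_def restrict_UNIV)
qed

lemma L_shift_Hom: "L_shift C r M \<in> Hom (PFun C) (L_obj C rho_diag r M) (shift_obj (- r) M)"
  using natural_iso_L_shift by (simp add: natural_iso_def)

lemma R_shift_Hom: "R_shift C r M \<in> Hom (PFun C) (R_obj C rho_diag r M) (shift_obj r M)"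
  using natural_iso_R_shift by (simp add: natural_iso_def)

text \<open>Passes from pointwise invertibility to invertibility in the functor category, as the
  transport over \<open>PFun C\<close> requires.\<close>

lemma is_iso_L_shift: "is_iso (PFun C) (L_shift C r M)"
  by (rule is_iso_Fun[OF category_poset_cat C natural_iso_L_shift])

lemma is_iso_R_shift: "is_iso (PFun C) (R_shift C r M)"
  by (rule is_iso_Fun[OF category_poset_cat C natural_iso_R_shift])

end

section \<open>Action of L_r and R_r on morphisms, the adjoint, and the interleaving
  equations\<close>

lemma L_arr_cmpt:
  assumes f: "f \<in> Hom (PFun C) M N"
  shows "cmpt (L_arr C rho_diag r f) a = alpha C rho_diag r a N (a - vec r) \<cdot>
    (cmpt f (a - vec r) \<cdot> inv_arr C (alpha C rho_diag r a M (a - vec r)))"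
proof -
  have M: "is_functor (poset_cat UNIV) C M" and N: "is_functor (poset_cat UNIV) C N"
    and dom: "nt_dom f = M" "nt_cod f = N"
    and nat: "\<And>x y. x \<le> y \<Longrightarrow> cmpt f y \<cdot> farr M (x, y) = farr N (x, y) \<cdot> cmpt f x"
    using f by (auto simp: Hom_Fun_iff)
  have hom: "cmpt f x \<in> Hom C (fobj M x) (fobj N x)" for x
    using Hom_Fun_cmpt[OF f] by simp
  note al = alpha_Hom[OF N]
  \<comment> \<open>The cocone condition for \<alpha> after \<open>f\<close>: naturality of
    \<open>f\<close> moves the structure map from \<open>M\<close> to \<open>N\<close>, where
    \<alpha> absorbs it.\<close>
  have "(alpha C rho_diag r a N y \<cdot> cmpt f y) \<cdot> farr M (x, y) = alpha C rho_diag r a N x \<cdot> cmpt f x"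
    if "x \<le> y" "y \<le> a - vec r" for x y
    using Comp_assoc[OF functor_poset_Hom[OF M _ _ that(1)] hom al[OF that(2)]]
      Comp_assoc[OF hom functor_poset_Hom[OF N _ _ that(1)] al[OF that(2)]]
      nat[OF that(1)] alpha_comp_farr[OF N that] by simp
  then have "cmpt (L_arr C rho_diag r f) a = (alpha C rho_diag r a N (a - vec r) \<cdot> cmpt f (a - vec r))
      \<cdot> inv_arr C (alpha C rho_diag r a M (a - vec r))"
    using L_obj_Obj[OF N] Comp_Hom[OF hom al]
    by (subst colim_induced_down_set[OF M, symmetric]) (auto simp: L_arr_def dom)
  then show ?thesis
    using Comp_assoc[OF inv_arr(1)[OF is_iso_alpha[OF M] alpha_Hom[OF M]] hom al] by simp
qed

lemma R_arr_cmpt: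
  assumes f: "f \<in> Hom (PFun C) M N"
  shows "cmpt (R_arr C rho_diag r f) a = inv_arr C (beta C rho_diag r a N (a + vec r)) \<cdot>
    (cmpt f (a + vec r) \<cdot> beta C rho_diag r a M (a + vec r))"
proof -
  have M: "is_functor (poset_cat UNIV) C M" and N: "is_functor (poset_cat UNIV) C N"
    and dom: "nt_dom f = M" "nt_cod f = N"
    and nat: "\<And>x y. x \<le> y \<Longrightarrow> cmpt f y \<cdot> farr M (x, y) = farr N (x, y) \<cdot> cmpt f x"
    using f by (auto simp: Hom_Fun_iff)
  have hom: "cmpt f x \<in> Hom C (fobj M x) (fobj N x)" for x
    using Hom_Fun_cmpt[OF f] by simp
  note be = beta_Hom[OF M]
  have "farr N (x, y) \<cdot> (cmpt f x \<cdot> beta C rho_diag r a M x) = cmpt f y \<cdot> beta C rho_diag r a M y"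
    if "a + vec r \<le> x" "x \<le> y" for x y
    using Comp_assoc[OF be[OF that(1)] hom functor_poset_Hom[OF N _ _ that(2)]]
      Comp_assoc[OF be[OF that(1)] functor_poset_Hom[OF M _ _ that(2)] hom]
      nat[OF that(2)] farr_comp_beta[OF M that] by simp
  then show ?thesis
    using R_obj_Obj[OF M] Comp_Hom[OF be hom]
    by (subst lim_induced_up_set[OF N, symmetric]) (auto simp: R_arr_def dom)
qed

text \<open>Transport one level up: the family is now M \<mapsto> \<open>L_shift C r M\<close>, and
  \<open>L_arr_cmpt\<close> is the conjugation formula in components.\<close>

lemma natural_iso_L_functor:
  "natural_iso (PFun C) (PFun C) (L_functor C rho_diag r) (shift_functor C (- r))
     \<lparr>nt_dom = L_functor C rho_diag r, nt_cod = shift_functor C (- r),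
      cmpt = restrict (L_shift C r) (Obj (PFun C))\<rparr>"
proof (rule natural_iso_transport)
  fix f :: "(real ^ 'd, 'o, 'm) pntrans" assume f: "f \<in> Arr (PFun C)"
  let ?M = "nt_dom f" and ?N = "nt_cod f"
  have f': "f \<in> Hom (PFun C) ?M ?N" using f by (simp add: Hom_def)
  have M: "is_functor (poset_cat UNIV) C ?M" and N: "is_functor (poset_cat UNIV) C ?N"
    using f' by (simp_all add: Hom_Fun_iff)
  \<comment> \<open>The components of \<open>L_shift\<close> are inverses already, so inverting them
    once more restores \<alpha>.\<close>
  have inv: "inv_arr (PFun C) (L_shift C r ?N) = \<lparr>nt_dom = shift_obj (- r) ?N,
      nt_cod = L_obj C rho_diag r ?N, cmpt = (\<lambda>a. alpha C rho_diag r a ?N (a - vec r))\<rparr>"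
    using category.inv_arr_eqI[OF category_Fun[OF category_poset_cat C]
        inverse_arrows_Fun[OF category_poset_cat C natural_iso_L_shift[OF N]]]
    by (simp add: L_shift_def restrict_UNIV inv_arr_inv_arr is_iso_alpha[OF N])
  have "L_arr C rho_diag r f = inv_arr (PFun C) (L_shift C r ?N) \<cdot>\<^bsub>PFun C\<^esub>
      (shift_arr (- r) f \<cdot>\<^bsub>PFun C\<^esub> L_shift C r ?M)"
    unfolding inv
    by (rule ntrans_eqI) (auto simp: fun_eq_iff L_arr_cmpt[OF f'] L_shift_def vec_neg, auto simp: L_arr_def)
  then show "farr (L_functor C rho_diag r) f =
      inv_arr (PFun C) (L_shift C r (Cod (PFun C) f)) \<cdot>\<^bsub>PFun C\<^esub>
        (farr (shift_functor C (- r)) f \<cdot>\<^bsub>PFun C\<^esub> L_shift C r (Dom (PFun C) f))"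
    using f by (simp add: L_functor_def shift_functor_simps)
qed (auto simp: L_functor_def shift_functor_simps is_iso_L_shift L_shift_Hom
    intro!: category_Fun category_poset_cat C is_functor_shift_functor)

lemma natural_iso_R_functor:
  "natural_iso (PFun C) (PFun C) (R_functor C rho_diag r) (shift_functor C r)
     \<lparr>nt_dom = R_functor C rho_diag r, nt_cod = shift_functor C r,
      cmpt = restrict (R_shift C r) (Obj (PFun C))\<rparr>"
proof (rule natural_iso_transport)
  fix f :: "(real ^ 'd, 'o, 'm) pntrans" assume f: "f \<in> Arr (PFun C)"
  let ?M = "nt_dom f" and ?N = "nt_cod f"
  have f': "f \<in> Hom (PFun C) ?M ?N" using f by (simp add: Hom_def)
  have M: "is_functor (poset_cat UNIV) C ?M" and N: "is_functor (poset_cat UNIV) C ?N"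
    using f' by (simp_all add: Hom_Fun_iff)
  have inv: "inv_arr (PFun C) (R_shift C r ?N) = \<lparr>nt_dom = shift_obj r ?N,
      nt_cod = R_obj C rho_diag r ?N, cmpt = (\<lambda>a. inv_arr C (beta C rho_diag r a ?N (a + vec r)))\<rparr>"
    using category.inv_arr_eqI[OF category_Fun[OF category_poset_cat C]
        inverse_arrows_Fun[OF category_poset_cat C natural_iso_R_shift[OF N]]]
    by (simp add: R_shift_def restrict_UNIV)
  have "R_arr C rho_diag r f = inv_arr (PFun C) (R_shift C r ?N) \<cdot>\<^bsub>PFun C\<^esub>
      (shift_arr r f \<cdot>\<^bsub>PFun C\<^esub> R_shift C r ?M)"
    unfolding inv
    by (rule ntrans_eqI) (auto simp: fun_eq_iff R_arr_cmpt[OF f'] R_shift_def, auto simp: R_arr_def)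
  then show "farr (R_functor C rho_diag r) f =
      inv_arr (PFun C) (R_shift C r (Cod (PFun C) f)) \<cdot>\<^bsub>PFun C\<^esub>
        (farr (shift_functor C r) f \<cdot>\<^bsub>PFun C\<^esub> R_shift C r (Dom (PFun C) f))"
    using f by (simp add: R_functor_def shift_functor_simps)
qed (auto simp: R_functor_def shift_functor_simps is_iso_R_shift R_shift_Hom
    intro!: category_Fun category_poset_cat C is_functor_shift_functor)

text \<open>The adjoint is a definite description, so the candidate must satisfy the defining
  equations and be the only solution. Existence combines naturality of f = \<open>R_shift\<close> .
  p with the factorization of \<alpha> and \<beta> through the extreme elements; uniqueness needs
  only the extreme element, where \<alpha> is invertible.\<close>

lemma sharp_eq:
  fixes M N :: "(real ^ 'd, 'o, 'm) pfctr"
  assumes M: "is_functor (poset_cat UNIV) C M" and N: "is_functor (poset_cat UNIV) C N"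
    and p: "p \<in> Hom (PFun C) M (R_obj C rho_diag r N)"
  shows "sharp C rho_diag r M N p =
    shift_arr (- r) (R_shift C r N \<cdot>\<^bsub>PFun C\<^esub> p) \<cdot>\<^bsub>PFun C\<^esub> L_shift C r M"
proof -
  interpret P: category "PFun C :: ((real ^ 'd, 'o, 'm) pfctr, (real ^ 'd, 'o, 'm) pntrans) cat_data"
    by (intro category_Fun category_poset_cat C)
  define f where "f = R_shift C r N \<cdot>\<^bsub>PFun C\<^esub> p"
  define s where "s = shift_arr (- r) f \<cdot>\<^bsub>PFun C\<^esub> L_shift C r M"
  have f: "f \<in> Hom (PFun C) M (shift_obj r N)"
    unfolding f_def by (rule P.Comp_Hom[OF p R_shift_Hom[OF N]])
  \<comment> \<open>The codomain is literally \<open>N\<close>, since the shifts by r and - r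
    compose to the shift by 0.\<close>
  have "shift_arr (- r) f \<in> Hom (PFun C) (shift_obj (- r) M) N"
    using shift_arr_Hom[OF f, of "- r"] by (simp add: shift_obj_shift_obj shift_obj_0[OF N])
  then have s: "s \<in> Hom (PFun C) (L_obj C rho_diag r M) N"
    unfolding s_def by (rule P.Comp_Hom[OF L_shift_Hom[OF M]])
  have hf: "cmpt f x \<in> Hom C (fobj M x) (fobj N (x + vec r))" for x
    using Hom_Fun_cmpt[OF f] by simp
  have fx: "cmpt f x = beta C rho_diag r x N (x + vec r) \<cdot> cmpt p x" for x
    by (simp add: f_def R_shift_def)
  have al: "alpha C rho_diag r a M (a - vec r) \<in> Hom C (fobj M (a - vec r)) (fobj (L_obj C rho_diag r M) a)"
    for a by (rule alpha_Hom[OF M]) simp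
  have cs: "cmpt s a \<cdot> alpha C rho_diag r a M (a - vec r) = cmpt f (a - vec r)" for a
    using inv_arr_comp_cancel(4)[OF is_iso_alpha[OF M] al hf]
    by (simp add: s_def L_shift_def vec_neg)
  have hs: "cmpt s a \<in> Hom C (fobj (L_obj C rho_diag r M) a) (fobj N a)" for a
    using Hom_Fun_cmpt[OF s] by simp
  have s_eq: "cmpt s a \<cdot> alpha C rho_diag r a M x = beta C rho_diag r x N a \<cdot> cmpt p x"
    if x: "x \<le> a - vec r" for a x
  proof -
    have x': "x + vec r \<le> a" using x by (simp add: diff_vec_le_iff)
    have hp: "cmpt p x \<in> Hom C (fobj M x) (fobj (R_obj C rho_diag r N) x)"
      using Hom_Fun_cmpt[OF p] by simp
    have "cmpt s a \<cdot> alpha C rho_diag r a M x = cmpt s a \<cdot>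
        (alpha C rho_diag r a M (a - vec r) \<cdot> farr M (x, a - vec r))"
      using alpha_eq[OF M x] by simp
    also have "\<dots> = cmpt f (a - vec r) \<cdot> farr M (x, a - vec r)"
      using Comp_assoc[OF functor_poset_Hom[OF M _ _ x] alpha_Hom[OF M] hs] cs by simp
    \<comment> \<open>Naturality of \<open>f\<close> along x \<le> a - r; in N(r) the upper end
      becomes a - r + r = a.\<close>
    also have "\<dots> = farr N (x + vec r, a) \<cdot> cmpt f x"
      using Hom_PFun_natural[OF f x] x by simp
    also have "\<dots> = beta C rho_diag r x N a \<cdot> cmpt p x"
      unfolding fx beta_eq[OF N x']
      using Comp_assoc[OF hp beta_Hom[OF N] functor_poset_Hom[OF N _ _ x']] by simp
    finally show ?thesis .
  qed
  have s_unique: "s' = s" if s': "s' \<in> Hom (PFun C) (L_obj C rho_diag r M) N"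
    and eq: "\<And>a x. x \<le> a - vec r \<Longrightarrow>
      cmpt s' a \<cdot> alpha C rho_diag r a M x = beta C rho_diag r x N a \<cdot> cmpt p x" for s'
  proof (rule ntrans_eqI)
    show "nt_dom s' = nt_dom s" "nt_cod s' = nt_cod s"
      using s s' by (auto simp: Hom_Fun_iff)
    show "cmpt s' = cmpt s"
    proof
      fix a
      have hs': "cmpt s' a \<in> Hom C (fobj (L_obj C rho_diag r M) a) (fobj N a)"
        using Hom_Fun_cmpt[OF s'] by simp
      \<comment> \<open>Only the equation at x = a - r enters; there the right-hand side is the
        component of f.\<close>
      have "cmpt s' a \<cdot> alpha C rho_diag r a M (a - vec r) = cmpt s a \<cdot> alpha C rho_diag r a M (a - vec r)"
        using eq[of "a - vec r" a] cs[of a] fx[of "a - vec r"] by simp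
      from arg_cong[OF this, of "\<lambda>h. h \<cdot> inv_arr C (alpha C rho_diag r a M (a - vec r))"]
      show "cmpt s' a = cmpt s a"
        unfolding inv_arr_comp_cancel(3)[OF is_iso_alpha[OF M] al hs]
          inv_arr_comp_cancel(3)[OF is_iso_alpha[OF M] al hs'] .
    qed
  qed
  show ?thesis
    unfolding sharp_def f_def[symmetric] s_def[symmetric] down_set_rho_diag[OF r] Ball_def atMost_iff
    by (rule the_equality) (use s s_eq s_unique in blast)+
qed

text \<open>Treats one of the two equations; the other is the same statement with (M, p) and (N, q)
  exchanged. At every a both composites lead from the chosen colimit to the chosen limit, hence
  carry the same inverse isomorphisms at their ends.\<close>

lemma e_map_eq_iff:
  fixes M N :: "(real ^ 'd, 'o, 'm) pfctr"
  assumes M: "is_functor (poset_cat UNIV) C M" and N: "is_functor (poset_cat UNIV) C N"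
    and p: "p \<in> Hom (PFun C) M (R_obj C rho_diag r N)"
    and q: "q \<in> Hom (PFun C) N (R_obj C rho_diag r M)"
  shows "e_map C rho_diag r M = q \<cdot>\<^bsub>PFun C\<^esub> sharp C rho_diag r M N p \<longleftrightarrow>
    shift_arr r (R_shift C r M \<cdot>\<^bsub>PFun C\<^esub> q) \<cdot>\<^bsub>PFun C\<^esub> (R_shift C r N \<cdot>\<^bsub>PFun C\<^esub> p) =
      canonical_shift (2 * r) M"
proof -
  interpret P: category "PFun C :: ((real ^ 'd, 'o, 'm) pfctr, (real ^ 'd, 'o, 'm) pntrans) cat_data"
    by (intro category_Fun category_poset_cat C)
  define f where "f = R_shift C r N \<cdot>\<^bsub>PFun C\<^esub> p"
  define g where "g = R_shift C r M \<cdot>\<^bsub>PFun C\<^esub> q"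
  let ?\<alpha> = "\<lambda>a. inv_arr C (alpha C rho_diag r a M (a - vec r))"
  let ?\<beta> = "\<lambda>a. inv_arr C (beta C rho_diag r a M (a + vec r))"
  have f: "f \<in> Hom (PFun C) M (shift_obj r N)"
    unfolding f_def by (rule P.Comp_Hom[OF p R_shift_Hom[OF N]])
  have g: "g \<in> Hom (PFun C) N (shift_obj r M)"
    unfolding g_def by (rule P.Comp_Hom[OF q R_shift_Hom[OF M]])
  have nt_f: "nt_dom f = M" and nt_g: "nt_cod g = shift_obj r M" and nt_q: "nt_cod q = R_obj C rho_diag r M"
    using f g q by (simp_all add: Hom_Fun_iff)
  have hf: "cmpt f (a - vec r) \<in> Hom C (fobj M (a - vec r)) (fobj N a)" for a
    using Hom_Fun_cmpt[OF f, of "a - vec r"] by simp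
  have hg: "cmpt g a \<in> Hom C (fobj N a) (fobj M (a + vec r))" for a
    using Hom_Fun_cmpt[OF g] by simp
  have hq: "cmpt q a \<in> Hom C (fobj N a) (fobj (R_obj C rho_diag r M) a)" for a
    using Hom_Fun_cmpt[OF q] by simp
  have be: "beta C rho_diag r a M (a + vec r) \<in> Hom C (fobj (R_obj C rho_diag r M) a) (fobj M (a + vec r))" for a
    by (rule beta_Hom[OF M]) simp
  have al: "alpha C rho_diag r a M (a - vec r) \<in> Hom C (fobj M (a - vec r)) (fobj (L_obj C rho_diag r M) a)" for a
    by (rule alpha_Hom[OF M]) simp
  note ih = inv_arr(1)[OF is_iso_alpha[OF M] al] inv_arr(1)[OF is_iso_beta[OF M] be]
  have le: "a - vec r \<le> a" "a \<le> a + vec r" for a :: "real ^ 'd"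
    by (rule diff_vec_le[OF r], rule le_add_vec[OF r])
  have hM: "farr M (a - vec r, a) \<in> Hom C (fobj M (a - vec r)) (fobj M a)"
    "farr M (a, a + vec r) \<in> Hom C (fobj M a) (fobj M (a + vec r))" for a
    by (rule functor_poset_Hom[OF M UNIV_I UNIV_I le(1)[of a]],
        rule functor_poset_Hom[OF M UNIV_I UNIV_I le(2)[of a]])
  have hMM: "farr M (a - vec r, a + vec r) \<in> Hom C (fobj M (a - vec r)) (fobj M (a + vec r))" for a
    using order_trans[OF le] by (auto intro: functor_poset_Hom[OF M])
  have MM: "farr M (a, a + vec r) \<cdot> farr M (a - vec r, a) = farr M (a - vec r, a + vec r)" for a
    by (rule functor_poset_Comp[OF M]) (use le in auto)
  have eta_L: "cmpt (eta_L C rho_diag r M) a = farr M (a - vec r, a) \<cdot> ?\<alpha> a" for a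
  proof -
    have "x \<le> a" if "x \<le> a - vec r" for x
      using order_trans[OF that le(1)] .
    then show ?thesis
      unfolding eta_L_def ntrans.simps
      by (intro colim_induced_down_set[OF M] functor_Obj[OF M] functor_poset_Hom[OF M]
          functor_poset_Comp[OF M]) auto
  qed
  have eta_R: "cmpt (eta_R C rho_diag r M) a = ?\<beta> a \<cdot> farr M (a, a + vec r)" for a
  proof -
    have "a \<le> x" if "a + vec r \<le> x" for x
      using order_trans[OF le(2) that] .
    then show ?thesis
      unfolding eta_R_def ntrans.simps
      by (intro lim_induced_up_set[OF M] functor_Obj[OF M] functor_poset_Hom[OF M]
          functor_poset_Comp[OF M]) auto
  qed
  \<comment> \<open>The structure maps from a - r to a and from a to a + r meet in the middle and
    merge.\<close>
  have e: "cmpt (eta_R C rho_diag r M) a \<cdot> cmpt (eta_L C rho_diag r M) a =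
      ?\<beta> a \<cdot> (farr M (a - vec r, a + vec r) \<cdot> ?\<alpha> a)" for a
    using Comp_assoc[OF ih(1) hM] Comp_assoc[OF Comp_Hom[OF ih(1) hM(1)] hM(2) ih(2)]
    by (simp add: eta_L eta_R MM)
  have "cmpt q a = ?\<beta> a \<cdot> cmpt g a" for a
    \<comment> \<open>g was defined as \<beta> after q, so q is recovered by inverting
      \<beta>.\<close>
    using inv_arr_comp_cancel(1)[OF is_iso_beta[OF M] be hq] by (simp add: g_def R_shift_def)
  then have s: "cmpt q a \<cdot> (cmpt f (a - vec r) \<cdot> ?\<alpha> a) = ?\<beta> a \<cdot> ((cmpt g a \<cdot> cmpt f (a - vec r)) \<cdot> ?\<alpha> a)" for a
    using Comp_assoc[OF Comp_Hom[OF ih(1) hf] hg ih(2)] Comp_assoc[OF ih(1) hf hg] by simp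
  have "e_map C rho_diag r M = q \<cdot>\<^bsub>PFun C\<^esub> sharp C rho_diag r M N p \<longleftrightarrow>
      (\<forall>a. ?\<beta> a \<cdot> (farr M (a - vec r, a + vec r) \<cdot> ?\<alpha> a) =
        ?\<beta> a \<cdot> ((cmpt g a \<cdot> cmpt f (a - vec r)) \<cdot> ?\<alpha> a))"
    unfolding sharp_eq[OF M N p] f_def[symmetric] s[symmetric] e[symmetric]
    using nt_q by (simp add: e_map_def fun_eq_iff L_shift_def vec_neg restrict_UNIV)
      (simp add: eta_L_def eta_R_def)
  also have "\<dots> \<longleftrightarrow> (\<forall>a. farr M (a - vec r, a + vec r) = cmpt g a \<cdot> cmpt f (a - vec r))"
    using iso_cancel[OF is_iso_inv_arr[OF is_iso_alpha[OF M]] ih(1)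
        is_iso_inv_arr[OF is_iso_beta[OF M]] ih(2) hMM Comp_Hom[OF hf hg]] by simp
  \<comment> \<open>The height equation is indexed by the midpoint of the step from a - r to a + r,
    the classical one by its lower end; translation by \<open>vec r\<close> is a bijection between
    the two.\<close>
  also have "\<dots> \<longleftrightarrow> (\<forall>a. farr M (a, a + vec (2 * r)) = cmpt g (a + vec r) \<cdot> cmpt f a)"
    (is "(\<forall>a. ?P a) \<longleftrightarrow> (\<forall>a. ?Q a)")
  proof -
    have v: "a + vec (2 * r) = a + vec r + vec r" for a :: "real ^ 'd"
      by (simp add: vec_eq_iff)
    have PQ: "?P (a + vec r) \<longleftrightarrow> ?Q a" for a
      by (simp add: v)
    have "?P a" if "\<forall>a. ?Q a" for a
      using PQ[of "a - vec r"] that by simp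
    then show ?thesis using PQ by blast
  qed
  \<comment> \<open>Equality of transformations also compares codomains, here M(r)(r) and
    M(2r).\<close>
  also have "\<dots> \<longleftrightarrow> shift_arr r g \<cdot>\<^bsub>PFun C\<^esub> f = canonical_shift (2 * r) M"
    using nt_f nt_g by (auto simp: canonical_shift_def fun_eq_iff shift_obj_shift_obj)
  finally show ?thesis by (simp only: f_def g_def)
qed

lemma height_interleaving_iff:
  fixes M N :: "(real ^ 'd, 'o, 'm) pfctr"
  assumes M: "is_functor (poset_cat UNIV) C M" and N: "is_functor (poset_cat UNIV) C N"
    and p: "p \<in> Hom (PFun C) M (R_obj C rho_diag r N)"
    and q: "q \<in> Hom (PFun C) N (R_obj C rho_diag r M)"
  shows "height_interleaving C rho_diag r M N p q \<longleftrightarrow>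
    interleaving C r M N (R_shift C r N \<cdot>\<^bsub>PFun C\<^esub> p) (R_shift C r M \<cdot>\<^bsub>PFun C\<^esub> q)"
proof -
  interpret P: category "PFun C :: ((real ^ 'd, 'o, 'm) pfctr, (real ^ 'd, 'o, 'm) pntrans) cat_data"
    by (intro category_Fun category_poset_cat C)
  show ?thesis
    unfolding height_interleaving_def interleaving_def
      e_map_eq_iff[OF M N p q] e_map_eq_iff[OF N M q p]
    using p q P.Comp_Hom[OF p R_shift_Hom[OF N]] P.Comp_Hom[OF q R_shift_Hom[OF M]] by blast
qed

text \<open>Composing with \<open>R_shift\<close> undoes composing with its inverse, so the previous
  equivalence can be read starting from the shift side.\<close>

lemma interleaving_iff:
  fixes M N :: "(real ^ 'd, 'o, 'm) pfctr"
  assumes M: "is_functor (poset_cat UNIV) C M" and N: "is_functor (poset_cat UNIV) C N"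
    and f: "f \<in> Hom (PFun C) M (shift_obj r N)" and g: "g \<in> Hom (PFun C) N (shift_obj r M)"
  shows "interleaving C r M N f g \<longleftrightarrow> height_interleaving C rho_diag r M N
    (inv_arr (PFun C) (R_shift C r N) \<cdot>\<^bsub>PFun C\<^esub> f) (inv_arr (PFun C) (R_shift C r M) \<cdot>\<^bsub>PFun C\<^esub> g)"
proof -
  interpret P: category "PFun C :: ((real ^ 'd, 'o, 'm) pfctr, (real ^ 'd, 'o, 'm) pntrans) cat_data"
    by (intro category_Fun category_poset_cat C)
  note iM = is_iso_R_shift[OF M] R_shift_Hom[OF M] and iN = is_iso_R_shift[OF N] R_shift_Hom[OF N]
  show ?thesis
    using height_interleaving_iff[OF M N
        P.Comp_Hom[OF f P.inv_arr(1)[OF iN]] P.Comp_Hom[OF g P.inv_arr(1)[OF iM]]]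
    unfolding P.inv_arr_comp_cancel(2)[OF iN f] P.inv_arr_comp_cancel(2)[OF iM g] by simp
qed

text \<open>Each notion contains the Hom memberships that the two equivalences presuppose, and these
  equivalences then provide the witnesses. For the distances this means that both infima range over
  the same set.\<close>

lemma ex_height_interleaving_iff:
  fixes M N :: "(real ^ 'd, 'o, 'm) pfctr"
  assumes M: "is_functor (poset_cat UNIV) C M" and N: "is_functor (poset_cat UNIV) C N"
  shows "(\<exists>p q. height_interleaving C rho_diag r M N p q) \<longleftrightarrow> (\<exists>f g. interleaving C r M N f g)"
proof
  assume "\<exists>p q. height_interleaving C rho_diag r M N p q"
  then obtain p q where pq: "height_interleaving C rho_diag r M N p q" by blast
  then show "\<exists>f g. interleaving C r M N f g"
    using height_interleaving_iff[OF M N, of p q]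
    unfolding height_interleaving_def[of C rho_diag] by blast
next
  assume "\<exists>f g. interleaving C r M N f g"
  then obtain f g where fg: "interleaving C r M N f g" by blast
  then show "\<exists>p q. height_interleaving C rho_diag r M N p q"
    using interleaving_iff[OF M N, of f g]
    unfolding interleaving_def[of C r] by blast
qed

end

theorem proposition3p11:
  fixes C :: "('o, 'm) cat_data"
    and small :: "(real ^ 'd) \<times> (real ^ 'd) \<Rightarrow> 'u"
  assumes small: "inj small"
    and complete: "complete_category TYPE('u) C"
    and cocomplete: "cocomplete_category TYPE('u) C"
  shows "(\<forall>r \<ge> 0. \<exists>\<psi> \<phi>.
           \<comment> \<open>(1)\<close>
           natural_iso (PFun C) (PFun C) (L_functor C rho_diag r) (shift_functor C (-r)) \<psi> \<and>
           natural_iso (PFun C) (PFun C) (R_functor C rho_diag r) (shift_functor C r) \<phi> \<and>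
           \<comment> \<open>the isomorphisms are the canonical ones\<close>
           (\<forall>M :: (real ^ 'd, 'o, 'm) pfctr \<in> Obj (PFun C). \<forall>a.
              cmpt (cmpt \<psi> M) a \<cdot>\<^bsub>C\<^esub> alpha C rho_diag r a M (a - vec r) = Ide C (fobj M (a - vec r)) \<and>
              cmpt (cmpt \<phi> M) a = beta C rho_diag r a M (a + vec r)) \<and>
           \<comment> \<open>(2)\<close>
           (\<forall>M :: (real ^ 'd, 'o, 'm) pfctr \<in> Obj (PFun C).
            \<forall>N \<in> Obj (PFun C).
              \<forall>f \<in> Hom (PFun C) M (shift_obj r N). \<forall>g \<in> Hom (PFun C) N (shift_obj r M).
                interleaving C r M N f g \<longleftrightarrow>
                height_interleaving C rho_diag r M N
                  (inv_arr (PFun C) (cmpt \<phi> N) \<cdot>\<^bsub>PFun C\<^esub> f)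
                  (inv_arr (PFun C) (cmpt \<phi> M) \<cdot>\<^bsub>PFun C\<^esub> g)))
       \<and> \<comment> \<open>(3)\<close>
         (\<forall>M :: (real ^ 'd, 'o, 'm) pfctr \<in> Obj (PFun C).
            \<forall>N \<in> Obj (PFun C). d_height C rho_diag M N = d_interleaving C M N)"
proof (intro conjI allI impI ballI)
  have C: "category C" using complete by (simp add: complete_category_def)
  fix r :: real assume r: "0 \<le> r"
  show "\<exists>\<psi> \<phi>.
     natural_iso (PFun C) (PFun C) (L_functor C rho_diag r) (shift_functor C (-r)) \<psi> \<and>
     natural_iso (PFun C) (PFun C) (R_functor C rho_diag r) (shift_functor C r) \<phi> \<and>
     (\<forall>M :: (real ^ 'd, 'o, 'm) pfctr \<in> Obj (PFun C). \<forall>a.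
        cmpt (cmpt \<psi> M) a \<cdot>\<^bsub>C\<^esub> alpha C rho_diag r a M (a - vec r) = Ide C (fobj M (a - vec r)) \<and>
        cmpt (cmpt \<phi> M) a = beta C rho_diag r a M (a + vec r)) \<and>
     (\<forall>M :: (real ^ 'd, 'o, 'm) pfctr \<in> Obj (PFun C).
      \<forall>N \<in> Obj (PFun C).
        \<forall>f \<in> Hom (PFun C) M (shift_obj r N). \<forall>g \<in> Hom (PFun C) N (shift_obj r M).
          interleaving C r M N f g \<longleftrightarrow>
          height_interleaving C rho_diag r M N
            (inv_arr (PFun C) (cmpt \<phi> N) \<cdot>\<^bsub>PFun C\<^esub> f)
            (inv_arr (PFun C) (cmpt \<phi> M) \<cdot>\<^bsub>PFun C\<^esub> g))"
  proof (intro exI conjI ballI allI)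
    \<comment> \<open>This goal and the next fix the witnesses \<psi> and \<phi>; the remaining
      claims then concern the families \<open>L_shift\<close> and \<open>R_shift\<close>.\<close>
    show "natural_iso (PFun C) (PFun C) (L_functor C rho_diag r) (shift_functor C (-r))
       \<lparr>nt_dom = L_functor C rho_diag r, nt_cod = shift_functor C (- r),
        cmpt = restrict (L_shift C r) (Obj (PFun C))\<rparr>"
      by (rule natural_iso_L_functor[OF C r])
    show "natural_iso (PFun C) (PFun C) (R_functor C rho_diag r) (shift_functor C r)
       \<lparr>nt_dom = R_functor C rho_diag r, nt_cod = shift_functor C r,
        cmpt = restrict (R_shift C r) (Obj (PFun C))\<rparr>"
      by (rule natural_iso_R_functor[OF C r])
  next
    fix M :: "(real ^ 'd, 'o, 'm) pfctr" and a :: "real ^ 'd" assume "M \<in> Obj (PFun C)"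
    then have M: "is_functor (poset_cat UNIV) C M" by simp
    then show "cmpt (cmpt \<lparr>nt_dom = L_functor C rho_diag r, nt_cod = shift_functor C (- r),
        cmpt = restrict (L_shift C r) (Obj (PFun C))\<rparr> M) a \<cdot>\<^bsub>C\<^esub> alpha C rho_diag r a M (a - vec r) =
      Ide C (fobj M (a - vec r))"
      using category.inv_arr(2)[OF C is_iso_alpha[OF C r M] alpha_Hom[OF C r M]]
      by (simp add: L_shift_def)
    show "cmpt (cmpt \<lparr>nt_dom = R_functor C rho_diag r, nt_cod = shift_functor C r,
        cmpt = restrict (R_shift C r) (Obj (PFun C))\<rparr> M) a = beta C rho_diag r a M (a + vec r)"
      using M by (simp add: R_shift_def)
  next
    fix M N :: "(real ^ 'd, 'o, 'm) pfctr" and f g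
    assume "M \<in> Obj (PFun C)" "N \<in> Obj (PFun C)"
      and fg: "f \<in> Hom (PFun C) M (shift_obj r N)" "g \<in> Hom (PFun C) N (shift_obj r M)"
    then have "is_functor (poset_cat UNIV) C M" "is_functor (poset_cat UNIV) C N" by simp_all
    then show "interleaving C r M N f g \<longleftrightarrow>
      height_interleaving C rho_diag r M N
        (inv_arr (PFun C) (cmpt \<lparr>nt_dom = R_functor C rho_diag r, nt_cod = shift_functor C r,
           cmpt = restrict (R_shift C r) (Obj (PFun C))\<rparr> N) \<cdot>\<^bsub>PFun C\<^esub> f)
        (inv_arr (PFun C) (cmpt \<lparr>nt_dom = R_functor C rho_diag r, nt_cod = shift_functor C r,
           cmpt = restrict (R_shift C r) (Obj (PFun C))\<rparr> M) \<cdot>\<^bsub>PFun C\<^esub> g)"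
      \<comment> \<open>Composition in \<open>PFun C\<close> stays folded so that the goal keeps the
        shape of \<open>interleaving_iff\<close>.\<close>
      using interleaving_iff[OF C r _ _ fg] by (simp del: Fun_simps(6))
  qed
next
  have C: "category C" using complete by (simp add: complete_category_def)
  fix M N :: "(real ^ 'd, 'o, 'm) pfctr"
  assume "M \<in> Obj (PFun C)" "N \<in> Obj (PFun C)"
  then show "d_height C rho_diag M N = d_interleaving C M N"
    unfolding d_height_def d_interleaving_def
    \<comment> \<open>The congruence rule makes \<open>0 \<le> r\<close> available while the
      existential part is rewritten.\<close>
    by (intro arg_cong[where f = Inf] Collect_cong)
      (simp add: ex_height_interleaving_iff[OF C] cong: conj_cong)
qed

end
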